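(* Every recurrent finite abelian processor can be emulated by a finite, directed acyclic abelian network whose nodes are adders, splitters and topplers.
   Context: $\mathbb{N}=\{0,1,2,\dots\}$. A processor with finite input alphabet $A$, finite output alphabet $B$ and finite state space $Q$ consists of transition maps $t_i:Q\to Q$ and output maps $o_i:Q\to\mathbb{N}^B$ ($i\in A$): on receiving letter $i$ in state $q$ it moves to $t_i(q)$ and emits $(o_i(q))_b$ copies of letter $b$. It is abelian if $t_it_j=t_jt_i$ and $o_i+o_j\circ t_i=o_j+o_i\circ t_j$ for all $i,j$. Every processor has an initial state $q^0$ from which every state is reachable by compositions of transition maps. It computes $F:\mathbb{N}^A\to\mathbb{N}^B$, where $F(\mathbf{x})$ is the total output when, from $q^0$, it receives $x_a$ letters $a$ for each $a$ (order-independent). It is recurrent if for every pair of states $q,q'$ some finite sequence of input letters takes it from $q$ to $q'$. An abelian network is a finite directed multigraph with pairwise disjoint sets of dangling input edges (no tail), output edges and trash edges (no head); each node carries a finite abelian processor (with an initial state) whose input alphabet is its set of incoming edges and output alphabet its set of outgoing edges. Given letters on input edges, the network repeatedly picks any non-output, non-trash edge carrying a letter and feeds one letter to the processor at its head, which changes state and places emitted letters on its outgoing edges; it halts when all letters lie on output or trash edges. Halting and output are independent of the choices; a network halting on all inputs computes a function and emulates a processor if it computes the same function. It is directed acyclic if its graph has no directed cycle. Gates: an adder (one state, two inputs, one output, computes $(x,y)\mapsto x+y$); a splitter (one state, one input, two outputs, computes $x\mapsto (x,x)$); for an integer $\lambda\ge2$, a $\lambda$-toppler with one input, one output and states $0,\dots,\lambda-1$: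 a letter received in state $q<\lambda-1$ moves it to $q+1$ emitting nothing, a letter received in state $\lambda-1$ moves it to $0$ emitting one letter; started in state $q$ it computes $x\mapsto\lfloor (x+q)/\lambda\rfloor$ (topplers may start in any state; a toppler started in a nonzero state is called primed).
   Formalization: Output edges of the network may also have no tail (such an edge never carries a letter); this is needed because a processor with an output letter that is never emitted cannot be emulated if every output edge must leave an adder, splitter or toppler. *)

theory Defs
  imports Main
begin

section \<open>Abelian processors\<close>

record ('q, 'a, 'b) processor =
  states :: "'q set"
  inputs :: "'a set"
  outputs :: "'b set"
  initial :: 'q
  transition :: "'a \<Rightarrow> 'q \<Rightarrow> 'q"
  emission :: "'a \<Rightarrow> 'q \<Rightarrow> 'b \<Rightarrow> nat"

text \<open>\<open>final_state P q w\<close> and \<open>total_output P q w b\<close> describe what happens when \<open>P\<close>, in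
  state \<open>q\<close>, is fed the letters of the word \<open>w\<close> from left to right.\<close>

primrec final_state :: "('q, 'a, 'b) processor \<Rightarrow> 'q \<Rightarrow> 'a list \<Rightarrow> 'q" where
  "final_state P q [] = q"
| "final_state P q (a # w) = final_state P (transition P a q) w"

primrec total_output :: "('q, 'a, 'b) processor \<Rightarrow> 'q \<Rightarrow> 'a list \<Rightarrow> 'b \<Rightarrow> nat" where
  "total_output P q [] b = 0"
| "total_output P q (a # w) b = emission P a q b + total_output P (transition P a q) w b"

locale finite_abelian_processor =
  fixes P :: "('q, 'a, 'b) processor"
  assumes finite_states: "finite (states P)"
    and finite_inputs: "finite (inputs P)"
    and finite_outputs: "finite (outputs P)"
    and initial_state: "initial P \<in> states P"
    and transition_closed:
      "\<And>i q. i \<in> inputs P \<Longrightarrow> q \<in> states P \<Longrightarrow> transition P i q \<in> states P"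
    and transition_commute:
      "\<And>i j q. i \<in> inputs P \<Longrightarrow> j \<in> inputs P \<Longrightarrow> q \<in> states P \<Longrightarrow>
        transition P i (transition P j q) = transition P j (transition P i q)"
    and emission_commute:
      "\<And>i j q b. i \<in> inputs P \<Longrightarrow> j \<in> inputs P \<Longrightarrow> q \<in> states P \<Longrightarrow> b \<in> outputs P \<Longrightarrow>
        emission P i q b + emission P j (transition P i q) b =
        emission P j q b + emission P i (transition P j q) b"
    and reachable:
      "\<And>q. q \<in> states P \<Longrightarrow> \<exists>w \<in> lists (inputs P). final_state P (initial P) w = q"

definition recurrent :: "('q, 'a, 'b) processor \<Rightarrow> bool" where
  "recurrent P \<longleftrightarrow>
    (\<forall>q \<in> states P. \<forall>q' \<in> states P. \<exists>w \<in> lists (inputs P). final_state P q w = q')"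

text \<open>An element of \<open>\<nat>\<^sup>A\<close> is represented by any function whose values on \<open>A\<close> are the given ones;
  a function \<open>F\<close> computed by \<open>P\<close> hence ignores the values of its argument outside \<open>inputs P\<close>,
  and only its values on \<open>outputs P\<close> matter.\<close>

definition processor_computes ::
  "('q, 'a, 'b) processor \<Rightarrow> (('a \<Rightarrow> nat) \<Rightarrow> 'b \<Rightarrow> nat) \<Rightarrow> bool" where
  "processor_computes P F \<longleftrightarrow>
    (\<forall>x. \<forall>w \<in> lists (inputs P). (\<forall>a \<in> inputs P. count_list w a = x a) \<longrightarrow>
      (\<forall>b \<in> outputs P. total_output P (initial P) w b = F x b))"


section \<open>Gates\<close>

definition is_adder :: "('q, 'a, 'b) processor \<Rightarrow> bool" where
  "is_adder P \<longleftrightarrow> states P = {initial P} \<and>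
    (\<exists>x y z. x \<noteq> y \<and> inputs P = {x, y} \<and> outputs P = {z} \<and>
      processor_computes P (\<lambda>X _. X x + X y))"

definition is_splitter :: "('q, 'a, 'b) processor \<Rightarrow> bool" where
  "is_splitter P \<longleftrightarrow> states P = {initial P} \<and>
    (\<exists>x y z. y \<noteq> z \<and> inputs P = {x} \<and> outputs P = {y, z} \<and>
      processor_computes P (\<lambda>X _. X x))"

definition is_toppler :: "(nat, 'a, 'b) processor \<Rightarrow> bool" where
  "is_toppler P \<longleftrightarrow>
    (\<exists>l x y. l \<ge> 2 \<and> states P = {..<l} \<and> initial P < l \<and> inputs P = {x} \<and> outputs P = {y} \<and>
      (\<forall>q < l. transition P x q = (if q < l - 1 then q + 1 else 0) \<and>
               emission P x q y = (if q < l - 1 then 0 else 1)))"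


section \<open>Abelian networks\<close>

record ('v, 'e, 'q) network =
  nodes :: "'v set"
  edges :: "'e set"
  tail :: "'e \<Rightarrow> 'v option"
  head :: "'e \<Rightarrow> 'v option"
  input_edges :: "'e set"
  output_edges :: "'e set"
  trash_edges :: "'e set"
  node_processor :: "'v \<Rightarrow> ('q, 'e, 'e) processor"

text \<open>An output edge is allowed to have no tail. Such an edge never carries a letter. Without
  it, an output letter that is never emitted could not be represented by gates, because every
  edge leaving a gate of an acyclic network of gates carries an unbounded number of letters as
  the inputs grow. All other edges have a tail unless they are input edges.\<close>

locale abelian_network =
  fixes N :: "('v, 'e, 'q) network"
  assumes finite_nodes: "finite (nodes N)"
    and finite_edges: "finite (edges N)"
    and dangling_subset: "input_edges N \<union> output_edges N \<union> trash_edges N \<subseteq> edges N"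
    and dangling_disjoint:
      "input_edges N \<inter> output_edges N = {}"
      "input_edges N \<inter> trash_edges N = {}"
      "output_edges N \<inter> trash_edges N = {}"
    and input_no_tail: "\<And>e. e \<in> input_edges N \<Longrightarrow> tail N e = None"
    and output_trash_no_head: "\<And>e. e \<in> output_edges N \<union> trash_edges N \<Longrightarrow> head N e = None"
    and head_node:
      "\<And>e. e \<in> edges N - (output_edges N \<union> trash_edges N) \<Longrightarrow> \<exists>v \<in> nodes N. head N e = Some v"
    and tail_node:
      "\<And>e. e \<in> edges N - (input_edges N \<union> output_edges N) \<Longrightarrow> \<exists>v \<in> nodes N. tail N e = Some v"
    and output_tail_node:
      "\<And>e v. e \<in> output_edges N \<Longrightarrow> tail N e = Some v \<Longrightarrow> v \<in> nodes N"
    and node_processor: "\<And>v. v \<in> nodes N \<Longrightarrow> finite_abelian_processor (node_processor N v)"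
    and node_inputs:
      "\<And>v. v \<in> nodes N \<Longrightarrow> inputs (node_processor N v) = {e \<in> edges N. head N e = Some v}"
    and node_outputs:
      "\<And>v. v \<in> nodes N \<Longrightarrow> outputs (node_processor N v) = {e \<in> edges N. tail N e = Some v}"

definition directed_acyclic :: "('v, 'e, 'q) network \<Rightarrow> bool" where
  "directed_acyclic N \<longleftrightarrow>
    acyclic {(u, v). \<exists>e \<in> edges N. tail N e = Some u \<and> head N e = Some v}"

text \<open>A configuration consists of the states of the nodes and the numbers of letters on the
  edges.\<close>

type_synonym ('v, 'e, 'q) config = "('v \<Rightarrow> 'q) \<times> ('e \<Rightarrow> nat)"

definition initial_config ::
  "('v, 'e, 'q) network \<Rightarrow> ('e \<Rightarrow> nat) \<Rightarrow> ('v, 'e, 'q) config" where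
  "initial_config N x =
    (\<lambda>v. initial (node_processor N v), \<lambda>e. if e \<in> input_edges N then x e else 0)"

inductive network_step ::
  "('v, 'e, 'q) network \<Rightarrow> ('v, 'e, 'q) config \<Rightarrow> ('v, 'e, 'q) config \<Rightarrow> bool"
  for N where
  "e \<in> edges N - (output_edges N \<union> trash_edges N) \<Longrightarrow> c e > 0 \<Longrightarrow> head N e = Some v \<Longrightarrow>
   network_step N (s, c)
     (s(v := transition (node_processor N v) e (s v)),
      \<lambda>f. (if f = e then c f - 1 else c f) +
          (if f \<in> edges N \<and> tail N f = Some v
           then emission (node_processor N v) e (s v) f else 0))"

definition halted :: "('v, 'e, 'q) network \<Rightarrow> ('v, 'e, 'q) config \<Rightarrow> bool" where
  "halted N C \<longleftrightarrow> (\<forall>e \<in> edges N - (output_edges N \<union> trash_edges N). snd C e = 0)"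

definition halts_on :: "('v, 'e, 'q) network \<Rightarrow> ('e \<Rightarrow> nat) \<Rightarrow> bool" where
  "halts_on N x \<longleftrightarrow>
    \<not> (\<exists>C. C 0 = initial_config N x \<and> (\<forall>n::nat. network_step N (C n) (C (Suc n))))"

definition network_computes ::
  "('v, 'e, 'q) network \<Rightarrow> (('e \<Rightarrow> nat) \<Rightarrow> 'e \<Rightarrow> nat) \<Rightarrow> bool" where
  "network_computes N G \<longleftrightarrow>
    (\<forall>x. halts_on N x \<and>
      (\<forall>C. (network_step N)\<^sup>*\<^sup>* (initial_config N x) C \<and> halted N C \<longrightarrow>
        (\<forall>e \<in> output_edges N. snd C e = G x e)))"

text \<open>The bijections \<open>i\<close> and \<open>j\<close> label the input and output edges by the letters of the two
  alphabets of the processor.\<close>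

definition emulates :: "('v, 'e, 's) network \<Rightarrow> ('q, 'a, 'b) processor \<Rightarrow> bool" where
  "emulates N P \<longleftrightarrow>
    (\<exists>i j F G. bij_betw i (inputs P) (input_edges N) \<and> bij_betw j (outputs P) (output_edges N) \<and>
      processor_computes P F \<and> network_computes N G \<and>
      (\<forall>x. \<forall>b \<in> outputs P. G x (j b) = F (x \<circ> i) b))"

end

(* The function computed by an abelian processor does not depend on the order of the letters, and
   is monotone and zero at zero. If the processor is recurrent, then some power of every letter
   fixes the initial state, so the function grows by a constant m over each period of a variable.
   Hermite's identity f = (sum over r < m of (f + r) div m) reduces the case m > 0 to m = 1, where
   f(x, t) = (t + (sum over j < l of f(x, j))) div l for the period l of the variable t. Induction
   on the number of variables therefore writes f in terms of sums and primed topplers; if m = 0,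
   then f does not depend on t by monotonicity.

   In an acyclic network, the number of letters traversing an edge is determined by recursion along
   the edges. It bounds the number of letters processed at any time, with equality upon halting. *)

theory Submission
  imports Defs "HOL-Library.Multiset" "HOL-Combinatorics.Permutations"
begin

section \<open>Functions computed by abelian processors\<close>

text \<open>Two features of gates shape the argument. As the inputs grow, every edge leaving a gate
  of such an acyclic network carries unboundedly many letters, so neither the zero function nor a
  positive constant can be put on a wire. The zero function is therefore kept apart
  (\<open>gate_function0\<close>) and ends as an output edge without tail; the only constants at
  hand are initial states of topplers, which must stay below the threshold. The class on which the
  induction runs makes this possible: monotone functions, zero at zero, with a fixed increment under
  the shift of a variable by a period. Vanishing at zero is what forces the needed constant below
  the threshold. Dividing by \<open>m\<close> spoils the period \<open>l\<close> in the other
  variables but not its multiple \<open>m * l\<close>, so the period has to vary in the induction.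
  On the wiring side, a formula may reuse a variable while a wire can be read only once. Networks
  are therefore grown gate by gate with a stock of unread wires that splitters replenish, and new
  nodes and edges get larger numbers than all old ones, which makes the numbering a topological
  order.\<close>

lemma final_state_append:
  "final_state P q (u @ w) = final_state P (final_state P q u) w"
  by (induction u arbitrary: q) auto

lemma total_output_append:
  "total_output P q (u @ w) b = total_output P q u b + total_output P (final_state P q u) w b"
  by (induction u arbitrary: q) auto

text \<open>An arbitrary choice avoids fixing an enumeration of the alphabet; order-independence
  makes the choice immaterial.\<close>

definition word_of :: "'a set \<Rightarrow> ('a \<Rightarrow> nat) \<Rightarrow> 'a list" where
  "word_of A x = (SOME w. w \<in> lists A \<and> (\<forall>a\<in>A. count_list w a = x a))"

lemma word_of:
  assumes "finite A"
  shows "word_of A x \<in> lists A" "a \<in> A \<Longrightarrow> count_list (word_of A x) a = x a"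
proof -
  have "\<exists>w. w \<in> lists A \<and> (\<forall>a\<in>A. count_list w a = x a)"
    using assms
  proof (induction A rule: finite_induct)
    case (insert c A)
    then obtain w where w: "w \<in> lists A" "\<forall>a\<in>A. count_list w a = x a" by blast
    have "count_list w c = 0"
      using w(1) insert.hyps(2) by (auto simp: count_list_0_iff)
    moreover have "count_list (replicate k c) a = (if a = c then k else 0)" for k a
      by (induction k) auto
    ultimately show ?case
      using w insert.hyps(2)
      by (intro exI[of _ "replicate (x c) c @ w"]) (auto simp: in_listsI)
  qed auto
  from someI_ex[OF this, folded word_of_def]
  show "word_of A x \<in> lists A" "a \<in> A \<Longrightarrow> count_list (word_of A x) a = x a"
    by blast+
qed

lemma mset_eq_of_count_list:
  assumes "w \<in> lists A" "w' \<in> lists A" "\<And>a. a \<in> A \<Longrightarrow> count_list w a = count_list w' a"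
  shows "mset w = mset w'"
proof (rule multiset_eqI)
  fix a
  show "count (mset w) a = count (mset w') a"
    using assms count_list_0_iff[of w a] count_list_0_iff[of w' a]
    by (cases "a \<in> A") (auto simp: count_mset dest: in_listsD)
qed

definition state_after :: "('q, 'a, 'b) processor \<Rightarrow> ('a \<Rightarrow> nat) \<Rightarrow> 'q" where
  "state_after P x = final_state P (initial P) (word_of (inputs P) x)"

definition response :: "('q, 'a, 'b) processor \<Rightarrow> ('a \<Rightarrow> nat) \<Rightarrow> 'b \<Rightarrow> nat" where
  "response P x b = total_output P (initial P) (word_of (inputs P) x) b"

context finite_abelian_processor
begin

section \<open>Order-independence\<close>

lemma final_state_closed:
  "q \<in> states P \<Longrightarrow> w \<in> lists (inputs P) \<Longrightarrow> final_state P q w \<in> states P"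
  by (induction w arbitrary: q) (auto simp: transition_closed)

text \<open>The two abelian laws swap adjacent letters; \<open>a\<close> moves to the right past one
  letter of \<open>w\<close> at a time.\<close>

lemma rotate_letter:
  assumes "a \<in> inputs P" "w \<in> lists (inputs P)" "q \<in> states P"
  shows "final_state P q (a # w) = final_state P q (w @ [a])"
    and "b \<in> outputs P \<Longrightarrow> total_output P q (a # w) b = total_output P q (w @ [a]) b"
  using assms(2,3)
proof (induction w arbitrary: q)
  case (Cons c w)
  note [simp] = transition_closed transition_commute[OF assms(1), of c]
  { case 1
    then show ?case
      using Cons.IH(1)[of "transition P c q"] Cons.hyps assms(1) by simp
  next
    case 2
    then show ?case
      using Cons.IH(2)[of "transition P c q"] Cons.hyps assms(1) emission_commute[of c a q b]
      by simp
  }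
qed auto

text \<open>The first letter of \<open>w\<close> occurs somewhere in \<open>w'\<close>; rotating it
  to the front of \<open>w'\<close> leaves two shorter words processed from the same state.\<close>

lemma mset_cong:
  assumes "mset w = mset w'" "w \<in> lists (inputs P)" "q \<in> states P"
  shows "final_state P q w = final_state P q w'"
    and "b \<in> outputs P \<Longrightarrow> total_output P q w b = total_output P q w' b"
  using assms
proof (induction w arbitrary: w' q)
  case (Cons a w)
  have *: "final_state P q (a # w) = final_state P q w' \<and>
    (b \<in> outputs P \<longrightarrow> total_output P q (a # w) b = total_output P q w' b)"
    if prems: "mset (a # w) = mset w'" "a # w \<in> lists (inputs P)" "q \<in> states P" for w' q
  proof -
    from prems(1) have "a \<in> set w'" by (metis list.set_intros(1) set_mset_mset)
    then obtain u v where w': "w' = u @ a # v" by (auto simp: in_set_conv_decomp)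
    have "set w' = set (a # w)" using prems(1) by (metis set_mset_mset)
    then have uv: "u \<in> lists (inputs P)" "v \<in> lists (inputs P)" "a \<in> inputs P"
      "w \<in> lists (inputs P)"
      using prems(2) w' by auto
    have q': "transition P a q \<in> states P" using uv prems(3) by (simp add: transition_closed)
    have m: "mset w = mset (u @ v)" using prems(1) w' by simp
    have "final_state P q w' = final_state P (final_state P q (u @ [a])) v"
      by (simp add: w' final_state_append)
    also have "\<dots> = final_state P (transition P a q) (u @ v)"
      using rotate_letter(1)[OF uv(3,1) prems(3)] by (simp add: final_state_append)
    finally have 1: "final_state P q (a # w) = final_state P q w'"
      using Cons.IH(1)[OF m uv(4) q'] by simp
    have 2: "total_output P q (a # w) b = total_output P q w' b" if "b \<in> outputs P"
    proof -
      have "total_output P q w' b =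
          total_output P q (u @ [a]) b + total_output P (final_state P q (u @ [a])) v b"
        by (simp add: w' total_output_append final_state_append)
      also have "\<dots> = total_output P q (a # u) b + total_output P (final_state P q (a # u)) v b"
        using rotate_letter[OF uv(3,1) prems(3)] that by simp
      finally show ?thesis
        using Cons.IH(2)[OF that m uv(4) q'] by (simp add: total_output_append)
    qed
    from 1 2 show ?thesis by blast
  qed
  { case 1 then show ?case using * by blast
  next
    case 2 then show ?case using * by blast
  }
qed auto

lemma word_cong:
  assumes "w \<in> lists (inputs P)" "w' \<in> lists (inputs P)"
    "\<And>a. a \<in> inputs P \<Longrightarrow> count_list w a = count_list w' a" "q \<in> states P"
  shows "final_state P q w = final_state P q w'"
    and "b \<in> outputs P \<Longrightarrow> total_output P q w b = total_output P q w' b"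
  using mset_cong[OF mset_eq_of_count_list[OF assms(1-3)] assms(1,4)] by blast+

section \<open>Final state and output as functions of letter counts\<close>

lemma word_result:
  assumes "w \<in> lists (inputs P)" "\<And>a. a \<in> inputs P \<Longrightarrow> count_list w a = x a"
  shows "final_state P (initial P) w = state_after P x"
    and "b \<in> outputs P \<Longrightarrow> total_output P (initial P) w b = response P x b"
  unfolding state_after_def response_def
  using assms word_of[OF finite_inputs] initial_state by (intro word_cong; simp)+

lemma computes_response: "processor_computes P (response P)"
  unfolding processor_computes_def using word_result(2) by blast

lemma response_eqI:
  assumes "processor_computes P F" "b \<in> outputs P"
  shows "response P x b = F x b"
  unfolding response_def
  using assms word_of[OF finite_inputs] by (simp add: processor_computes_def)

lemma result_cong:
  assumes "\<And>a. a \<in> inputs P \<Longrightarrow> x a = y a"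
  shows "state_after P x = state_after P y"
    and "b \<in> outputs P \<Longrightarrow> response P x b = response P y b"
proof -
  let ?w = "word_of (inputs P) x"
  have w: "?w \<in> lists (inputs P)" "\<And>a. a \<in> inputs P \<Longrightarrow> count_list ?w a = y a"
    using assms word_of[OF finite_inputs] by simp_all
  show "state_after P x = state_after P y"
    using word_result(1)[OF w] by (simp add: state_after_def)
  show "b \<in> outputs P \<Longrightarrow> response P x b = response P y b"
    using word_result(2)[OF w] by (simp add: response_def)
qed

lemma result_zero: "state_after P (\<lambda>_. 0) = initial P" "b \<in> outputs P \<Longrightarrow> response P (\<lambda>_. 0) b = 0"
  using word_result[of "[]" "\<lambda>_. 0"] by auto

lemma result_add_word:
  assumes "w \<in> lists (inputs P)" "\<And>a. a \<in> inputs P \<Longrightarrow> y a = x a + count_list w a"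
  shows "state_after P y = final_state P (state_after P x) w"
    and "b \<in> outputs P \<Longrightarrow>
      response P y b = response P x b + total_output P (state_after P x) w b"
proof -
  let ?u = "word_of (inputs P) x"
  have u: "?u @ w \<in> lists (inputs P)"
    "\<And>a. a \<in> inputs P \<Longrightarrow> count_list (?u @ w) a = y a"
    using assms word_of[OF finite_inputs] by simp_all
  show "state_after P y = final_state P (state_after P x) w"
    using word_result(1)[OF u] by (simp add: state_after_def final_state_append)
  show "b \<in> outputs P \<Longrightarrow>
      response P y b = response P x b + total_output P (state_after P x) w b"
    using word_result(2)[OF u] by (simp add: state_after_def response_def total_output_append)
qed

lemma result_add_letter:
  assumes "a \<in> inputs P"
  shows "state_after P (x(a := Suc (x a))) = transition P a (state_after P x)"
    and "b \<in> outputs P \<Longrightarrow>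
      response P (x(a := Suc (x a))) b = response P x b + emission P a (state_after P x) b"
  using result_add_word[of "[a]" "x(a := Suc (x a))" x] assms by simp_all

text \<open>Since \<open>x\<close> lies below \<open>y\<close> on the alphabet,
  \<open>y a - x a\<close> is a genuine letter count: \<open>y\<close> is \<open>x\<close> followed
  by further letters, which can only add output.\<close>

lemma response_mono:
  assumes "\<And>a. a \<in> inputs P \<Longrightarrow> x a \<le> y a" "b \<in> outputs P"
  shows "response P x b \<le> response P y b"
proof -
  let ?w = "word_of (inputs P) (\<lambda>a. y a - x a)"
  have "?w \<in> lists (inputs P)" "\<And>a. a \<in> inputs P \<Longrightarrow> y a = x a + count_list ?w a"
    using assms(1) word_of[OF finite_inputs] by simp_all
  from result_add_word(2)[OF this assms(2)] show ?thesis by simp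
qed

text \<open>By pigeonhole the powers \<open>i < j\<close> of \<open>a\<close> lead to the same
  state, which alone gives only eventual periodicity. Recurrence supplies a word \<open>w\<close>
  from that state back to the initial one; commuting \<open>w\<close> before the last
  \<open>j - i\<close> letters shows that these fix the initial state.\<close>

lemma recurrent_letter_period:
  assumes "recurrent P" "a \<in> inputs P"
  shows "\<exists>d>0. final_state P (initial P) (replicate d a) = initial P"
proof -
  let ?f = "\<lambda>k. final_state P (initial P) (replicate k a)"
  have in_lists: "replicate k a \<in> lists (inputs P)" for k
    using assms(2) by auto
  have "range ?f \<subseteq> states P"
    using in_lists final_state_closed initial_state by blast
  then have "\<not> inj ?f"
    using finite_states finite_subset finite_imageD infinite_UNIV_nat by blast
  then obtain i j where ij: "i < j" "?f i = ?f j"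
    unfolding inj_on_def by (metis nat_neq_iff)
  obtain w where w: "w \<in> lists (inputs P)" "final_state P (?f i) w = initial P"
    using assms(1) final_state_closed[OF initial_state in_lists] initial_state
    unfolding recurrent_def by blast
  have "mset (replicate j a @ w) = mset ((replicate i a @ w) @ replicate (j - i) a)"
    using ij(1) replicate_add[of i "j - i" a] by simp
  then have "final_state P (initial P) (replicate j a @ w)
      = final_state P (initial P) ((replicate i a @ w) @ replicate (j - i) a)"
    using w(1) in_lists initial_state by (intro mset_cong) auto
  then have "initial P = ?f (j - i)"
    using ij(2) w(2) by (simp add: final_state_append)
  then show ?thesis
    using ij(1) by (intro exI[of _ "j - i"]) simp
qed

lemma replicate_period_mult:
  assumes "final_state P q (replicate d a) = q"
  shows "final_state P q (replicate (k * d) a) = q"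
  using assms by (induction k) (simp_all add: replicate_add final_state_append)

lemma recurrent_common_period:
  assumes "recurrent P"
  shows "\<exists>d\<ge>2. \<forall>a\<in>inputs P. final_state P (initial P) (replicate d a) = initial P"
proof -
  obtain d where d: "\<And>a. a \<in> inputs P \<Longrightarrow>
      d a > 0 \<and> final_state P (initial P) (replicate (d a) a) = initial P"
    using recurrent_letter_period[OF assms] by metis
  \<comment> \<open>The factor 2 only ensures \<open>?d \<ge> 2\<close>, because the period will
    serve as the threshold of a toppler.\<close>
  let ?d = "2 * (\<Prod>a\<in>inputs P. d a)"
  have "(\<Prod>a\<in>inputs P. d a) > 0"
    using d by (intro prod_pos) blast
  then have "?d \<ge> 2" by simp
  moreover have "final_state P (initial P) (replicate ?d a) = initial P" if "a \<in> inputs P" for a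
  proof -
    have "?d = (2 * (\<Prod>c\<in>inputs P - {a}. d c)) * d a"
      using prod.remove[OF finite_inputs that, of d] by (simp only: mult.commute mult.left_commute)
    then show ?thesis
      using replicate_period_mult[of "initial P" "d a" a "2 * (\<Prod>c\<in>inputs P - {a}. d c)"] d[OF that] by (simp only:)
  qed
  ultimately show ?thesis by blast
qed

text \<open>Feeding the \<open>d\<close> letters first returns the processor to its initial state
  before the word for \<open>x\<close> starts. The increment is therefore the same for all
  \<open>x\<close>.\<close>

lemma response_period:
  assumes "a \<in> inputs P" "b \<in> outputs P"
    "final_state P (initial P) (replicate d a) = initial P"
  shows "response P (x(a := x a + d)) b =
    response P x b + total_output P (initial P) (replicate d a) b"
proof -
  let ?w = "word_of (inputs P) x"
  have cnt: "count_list (replicate d a) c = (if c = a then d else 0)" for c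
    by (induction d) auto
  have "replicate d a @ ?w \<in> lists (inputs P)"
    using assms(1) word_of[OF finite_inputs] by auto
  moreover have "count_list (replicate d a @ ?w) c = (x(a := x a + d)) c" if "c \<in> inputs P" for c
    using that word_of[OF finite_inputs] by (simp add: cnt)
  ultimately have "response P (x(a := x a + d)) b =
      total_output P (initial P) (replicate d a @ ?w) b"
    by (intro word_result(2)[symmetric] assms(2))
  then show ?thesis
    using assms(3) by (simp add: total_output_append response_def)
qed

end


section \<open>Functions computed by gates\<close>

text \<open>The window sum \<open>S t\<close> of \<open>l\<close> consecutive values grows by
  \<open>g (t + l) - g t = 1\<close> at each step, so it is \<open>t + S 0\<close>. Its terms lie
  between \<open>g t\<close> and \<open>g t + 1\<close>, hence \<open>S t div l\<close> recovers
  \<open>g t\<close>.\<close>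

lemma sum_shifts_of_quasiperiodic:
  fixes g :: "nat \<Rightarrow> nat"
  assumes "mono g" "\<And>t. g (t + l) = g t + 1" "l > 0"
  shows "g t = (t + (\<Sum>j<l. g j)) div l"
proof -
  define S where "S t = (\<Sum>j<l. g (t + j))" for t
  have step: "S (Suc t) = Suc (S t)" for t
  proof -
    have "S (Suc t) + g t = (\<Sum>j<Suc l. g (t + j))"
      unfolding S_def by (subst sum.lessThan_Suc_shift) simp
    also have "\<dots> = S t + g (t + l)" by (simp add: S_def)
    finally show ?thesis using assms(2) by simp
  qed
  have S: "S t = t + (\<Sum>j<l. g j)"
    by (induction t) (simp_all add: step, simp add: S_def)
  have "l * g t \<le> S t"
    using sum_mono[of "{..<l}" "\<lambda>_. g t" "\<lambda>j. g (t + j)"] monoD[OF assms(1)]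
    by (simp add: S_def)
  moreover have "S t < l * Suc (g t)"
  proof -
    obtain k where k: "l = Suc k" using assms(3) gr0_implies_Suc by blast
    \<comment> \<open>The term at shift 0 is exactly \<open>g t\<close>, so at most
      \<open>l - 1\<close> terms exceed it; this makes the upper bound on \<open>S t\<close>
      strict.\<close>
    have "g (t + Suc j) \<le> Suc (g t)" if "j < k" for j
      using that monoD[OF assms(1), of "t + Suc j" "t + l"] assms(2)[of t] k by simp
    then have "(\<Sum>j<k. g (t + Suc j)) \<le> k * Suc (g t)"
      using sum_mono[of "{..<k}" "\<lambda>j. g (t + Suc j)" "\<lambda>_. Suc (g t)"] by simp
    then show ?thesis
      unfolding S_def k by (subst sum.lessThan_Suc_shift) simp
  qed
  ultimately show ?thesis
    unfolding S[symmetric] by (metis div_nat_eqI)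
qed

text \<open>Passing from \<open>k\<close> to \<open>Suc k\<close> shifts the window of the sum: the
  term \<open>k div m\<close> leaves and \<open>(k + m) div m\<close>, larger by one,
  enters.\<close>

lemma hermite_identity_nat:
  fixes k m :: nat
  assumes "m > 0"
  shows "(\<Sum>r<m. (k + r) div m) = k"
proof -
  have step: "(\<Sum>r<m. (Suc k + r) div m) = Suc (\<Sum>r<m. (k + r) div m)" for k
  proof -
    have "(\<Sum>r<m. (Suc k + r) div m) + k div m = (\<Sum>r<Suc m. (k + r) div m)"
      by (subst sum.lessThan_Suc_shift) simp
    also have "\<dots> = (\<Sum>r<m. (k + r) div m) + (k + m) div m" by simp
    finally show ?thesis using assms div_add_self2[of m k] by linarith
  qed
  show ?thesis by (induction k) (simp_all only: step, simp)
qed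

text \<open>Splitters have no constructor: a formula may repeat a subterm or a variable at will, and
  copies are made only when the formula is wired.\<close>

inductive gate_function :: "nat \<Rightarrow> ((nat \<Rightarrow> nat) \<Rightarrow> nat) \<Rightarrow> bool" for n where
  variable: "i < n \<Longrightarrow> gate_function n (\<lambda>x. x i)"
| add: "gate_function n f \<Longrightarrow> gate_function n g \<Longrightarrow> gate_function n (\<lambda>x. f x + g x)"
| topple: "gate_function n f \<Longrightarrow> l \<ge> 2 \<Longrightarrow> q < l \<Longrightarrow> gate_function n (\<lambda>x. (f x + q) div l)"

text \<open>Every \<open>gate_function\<close> is unbounded, so zero has to be adjoined. Closure
  survives: adding zero changes nothing, and a primed toppler maps zero to
  \<open>q div l = 0\<close>.\<close>

definition gate_function0 :: "nat \<Rightarrow> ((nat \<Rightarrow> nat) \<Rightarrow> nat) \<Rightarrow> bool" where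
  "gate_function0 n f \<longleftrightarrow> f = (\<lambda>_. 0) \<or> gate_function n f"

lemma gate_function0_variable: "i < n \<Longrightarrow> gate_function0 n (\<lambda>x. x i)"
  by (simp add: gate_function0_def gate_function.variable)

lemma gate_function0_add:
  "gate_function0 n f \<Longrightarrow> gate_function0 n g \<Longrightarrow> gate_function0 n (\<lambda>x. f x + g x)"
  by (auto simp: gate_function0_def intro: gate_function.add)

lemma gate_function0_topple:
  "gate_function0 n f \<Longrightarrow> l \<ge> 2 \<Longrightarrow> q < l \<Longrightarrow> gate_function0 n (\<lambda>x. (f x + q) div l)"
  by (auto simp: gate_function0_def intro: gate_function.topple)

lemma gate_function0_sum:
  "(\<And>i. i \<in> I \<Longrightarrow> gate_function0 n (f i)) \<Longrightarrow> gate_function0 n (\<lambda>x. \<Sum>i\<in>I. f i x)"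
  by (induction I rule: infinite_finite_induct)
    (auto simp: gate_function0_add, simp_all add: gate_function0_def)

definition linear_periodic :: "nat \<Rightarrow> nat \<Rightarrow> ((nat \<Rightarrow> nat) \<Rightarrow> nat) \<Rightarrow> bool" where
  "linear_periodic k l f \<longleftrightarrow> (\<forall>i<k. \<exists>m. \<forall>x. f (x(i := x i + l)) = f x + m)"

text \<open>This stands in for having \<open>k\<close> arguments, so that the induction can
  eliminate a variable without changing the type of the function.\<close>

definition depends_below :: "nat \<Rightarrow> ((nat \<Rightarrow> nat) \<Rightarrow> nat) \<Rightarrow> bool" where
  "depends_below k f \<longleftrightarrow> (\<forall>x y. (\<forall>i<k. x i = y i) \<longrightarrow> f x = f y)"

text \<open>The value \<open>c r\<close> of the inner sum at zero becomes the initial state of a toppler.\<close>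

theorem gate_function0_of_linear_periodic:
  assumes "k \<le> n" "depends_below k f" "mono f" "f (\<lambda>_. 0) = 0" "l \<ge> 2" "linear_periodic k l f"
  shows "gate_function0 n f"
  using assms
proof (induction k arbitrary: f l)
  case 0
  then have "f = (\<lambda>_. 0)" unfolding depends_below_def by (metis less_nat_zero_code)
  then show ?case by (simp add: gate_function0_def)
next
  case (Suc k)
  have dep: "f x = f y" if "\<And>i. i \<le> k \<Longrightarrow> x i = y i" for x y
    using Suc.prems(2) that by (auto simp: depends_below_def less_Suc_eq_le)
  obtain m where m: "\<And>x. f (x(k := x k + l)) = f x + m"
    using Suc.prems(6) unfolding linear_periodic_def by blast
  show ?case
  proof (cases "m = 0")
    case True
    have mult: "f (x(k := j * l)) = f (x(k := 0))" for x j
      using m[of "x(k := j' * l)" for j'] True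
      by (induction j) (simp_all add: add.commute)
    have reset: "f x = f (x(k := 0))" for x
    proof (rule antisym)
      \<comment> \<open>Coordinate \<open>k\<close> is rounded up to a multiple of the period, where
        \<open>f\<close> takes the same value as at 0; monotonicity then squeezes
        \<open>f x\<close>.\<close>
      have "x \<le> x(k := x k * l)" using Suc.prems(5) by (simp add: le_fun_def)
      then show "f x \<le> f (x(k := 0))"
        using monoD[OF Suc.prems(3)] mult by metis
      show "f (x(k := 0)) \<le> f x"
        by (intro monoD[OF Suc.prems(3)]) (simp add: le_fun_def)
    qed
    have "depends_below k f"
      unfolding depends_below_def
    proof (intro allI impI)
      fix x y :: "nat \<Rightarrow> nat"
      assume "\<forall>i<k. x i = y i"
      then have "f (x(k := 0)) = f (y(k := 0))" by (intro dep) simp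
      then show "f x = f y" using reset[of x] reset[of y] by simp
    qed
    then show ?thesis
      using Suc.IH[of f l] Suc.prems by (simp add: linear_periodic_def)
  next
    case False
    \<comment> \<open>\<open>g r\<close> is a summand of Hermite's identity and grows by exactly 1
      over a period of variable \<open>k\<close>. In \<open>h r\<close> this variable is
      overwritten, so one variable fewer remains.\<close>
    define g where "g r x = (f x + r) div m" for r x
    define h where "h r x = (\<Sum>j<l. g r (x(k := j)))" for r x
    define c where "c r = h r (\<lambda>_. 0)" for r
    have g_mono: "mono (g r)" for r
      using Suc.prems(3) by (auto simp: g_def mono_def intro!: div_le_mono)
    have h_mono: "mono (h r)" for r
      unfolding h_def
      by (intro monoI sum_mono monoD[OF g_mono]) (simp add: le_fun_def)
    have c_le: "c r \<le> h r x" for r x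
      unfolding c_def by (intro monoD[OF h_mono]) (simp add: le_fun_def)
    have g_eq: "g r x = (x k + h r x) div l" for r x
    proof -
      have "mono (\<lambda>t. g r (x(k := t)))"
        by (intro monoI monoD[OF g_mono]) (simp add: le_fun_def)
      moreover have "g r (x(k := t + l)) = g r (x(k := t)) + 1" for t
        using m[of "x(k := t)"] False div_add_self1[of m "f (x(k := t)) + r"]
        by (simp add: g_def ac_simps)
      ultimately show ?thesis
        using sum_shifts_of_quasiperiodic[of "\<lambda>t. g r (x(k := t))" l "x k"] Suc.prems(5)
        by (simp add: h_def)
    qed
    have c_less: "c r < l" if "r < m" for r
    proof -
      \<comment> \<open>At zero the numerator of \<open>g r\<close> is just \<open>r < m\<close>;
        comparing with \<open>g_eq\<close> at zero gives \<open>c r div l = 0\<close>.\<close>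
      have "g r (\<lambda>_. 0) = 0" using that Suc.prems(4) by (simp add: g_def)
      then show ?thesis using g_eq[of r "\<lambda>_. 0"] Suc.prems(5) by (simp add: c_def div_eq_0_iff)
    qed
    \<comment> \<open>Subtracting \<open>c r\<close> restores the value zero at zero that the
      induction hypothesis demands.\<close>
    have h_gate: "gate_function0 n (\<lambda>x. h r x - c r)" for r
    proof (rule Suc.IH)
      show "k \<le> n" using Suc.prems(1) by simp
      show "depends_below k (\<lambda>x. h r x - c r)"
        unfolding depends_below_def
      proof (intro allI impI)
        fix x y :: "nat \<Rightarrow> nat"
        assume "\<forall>i<k. x i = y i"
        then have "f (x(k := j)) = f (y(k := j))" for j
          by (intro dep) simp
        then show "h r x - c r = h r y - c r" by (simp add: h_def g_def)
      qed
      show "mono (\<lambda>x. h r x - c r)"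
        using h_mono by (auto simp: mono_def intro!: diff_le_mono)
      show "h r (\<lambda>_. 0) - c r = 0" by (simp add: c_def)
      show "2 \<le> m * l" using Suc.prems(5) False
        by (metis One_nat_def Suc_leI mult_le_mono nat_mult_1 neq0_conv)
      \<comment> \<open>Over one period \<open>l\<close> of another variable, \<open>f\<close> grows
        by some \<open>d\<close> that \<open>m\<close> need not divide. Over \<open>m\<close>
        periods it grows by \<open>m * d\<close>, so the quotient \<open>g r\<close> grows by
        exactly \<open>d\<close>.\<close>
      show "linear_periodic k (m * l) (\<lambda>x. h r x - c r)"
        unfolding linear_periodic_def
      proof (intro allI impI)
        fix i assume i: "i < k"
        then obtain d where d: "\<And>x. f (x(i := x i + l)) = f x + d"
          using Suc.prems(6) unfolding linear_periodic_def by (meson less_SucI)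
        have "f (x(i := x i + p * l)) = f x + p * d" for x p
        proof (induction p)
          case (Suc p)
          have "f (x(i := x i + Suc p * l)) = f ((x(i := x i + p * l))(i := (x(i := x i + p * l)) i + l))"
            by (simp only: fun_upd_upd fun_upd_same mult_Suc add.assoc add.commute[of l])
          also have "\<dots> = f x + Suc p * d" by (simp only: d Suc.IH mult_Suc)
          finally show ?case .
        qed simp
        then have "f (x(i := x i + m * l)) + r = (f x + r) + m * d" for x by simp
        then have "g r (x(i := x i + m * l)) = g r x + d" for x
          unfolding g_def using False by (metis add.commute div_mult_self2)
        from this[of "x(k := j)" for x j]
        have "g r (x(k := j, i := x i + m * l)) = g r (x(k := j)) + d" for x j
          using i by simp
        then have "h r (x(i := x i + m * l)) = h r x + l * d" for x
          using i by (simp add: h_def fun_upd_twist sum.distrib)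
        \<comment> \<open>By \<open>c_le\<close> the subtraction is never truncated, so increments
          pass through it.\<close>
        then have "h r (x(i := x i + m * l)) - c r = (h r x - c r) + l * d" for x
          using c_le by simp
        then show "\<exists>d. \<forall>x. h r (x(i := x i + m * l)) - c r = h r x - c r + d" by blast
      qed
    qed
    have "gate_function0 n (g r)" if "r < m" for r
    proof -
      have "g r = (\<lambda>x. ((x k + (h r x - c r)) + c r) div l)"
        by (intro ext) (simp only: g_eq add.assoc le_add_diff_inverse2[OF c_le])
      moreover have "gate_function0 n (\<lambda>x. ((x k + (h r x - c r)) + c r) div l)"
        using c_less[OF that] Suc.prems(1,5) h_gate
        by (intro gate_function0_topple gate_function0_add gate_function0_variable) auto
      ultimately show ?thesis by simp
    qed
    then have "gate_function0 n (\<lambda>x. \<Sum>r<m. g r x)"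
      by (intro gate_function0_sum) simp
    moreover have "f = (\<lambda>x. \<Sum>r<m. g r x)"
      using False by (simp add: g_def hermite_identity_nat fun_eq_iff)
    ultimately show ?thesis by simp
  qed
qed


section \<open>Gates\<close>

definition adder :: "'e \<Rightarrow> 'e \<Rightarrow> 'e \<Rightarrow> (nat, 'e, 'e) processor" where
  "adder x y z = \<lparr>states = {0}, inputs = {x, y}, outputs = {z}, initial = 0,
    transition = \<lambda>_ _. 0, emission = \<lambda>_ _ _. 1\<rparr>"

definition splitter :: "'e \<Rightarrow> 'e \<Rightarrow> 'e \<Rightarrow> (nat, 'e, 'e) processor" where
  "splitter x y z = \<lparr>states = {0}, inputs = {x}, outputs = {y, z}, initial = 0,
    transition = \<lambda>_ _. 0, emission = \<lambda>_ _ _. 1\<rparr>"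

definition toppler :: "nat \<Rightarrow> nat \<Rightarrow> 'e \<Rightarrow> 'e \<Rightarrow> (nat, 'e, 'e) processor" where
  "toppler l q x y = \<lparr>states = {..<l}, inputs = {x}, outputs = {y}, initial = q,
    transition = \<lambda>_ s. if s < l - 1 then s + 1 else 0,
    emission = \<lambda>_ s _. if s < l - 1 then 0 else 1\<rparr>"

definition is_gate :: "(nat, 'e, 'e) processor \<Rightarrow> bool" where
  "is_gate P \<longleftrightarrow> is_adder P \<or> is_splitter P \<or> is_toppler P"

lemma abelian_adder: "finite_abelian_processor (adder x y z)"
  by unfold_locales (auto simp: adder_def intro!: bexI[of _ "[]"])

lemma abelian_splitter: "finite_abelian_processor (splitter x y z)"
  by unfold_locales (auto simp: splitter_def intro!: bexI[of _ "[]"])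

lemma total_output_unit_emission:
  assumes "\<And>a q. emission P a q b = 1"
  shows "total_output P q w b = length w"
  using assms by (induction w arbitrary: q) simp_all

lemma computes_adder:
  assumes "x \<noteq> y"
  shows "processor_computes (adder x y z) (\<lambda>X _. X x + X y)"
proof -
  have "length w = count_list w x + count_list w y" if "w \<in> lists {x, y}" for w
    using that assms by (induction w) auto
  then show ?thesis
    by (auto simp: processor_computes_def total_output_unit_emission adder_def)
qed

lemma computes_splitter: "processor_computes (splitter x y z) (\<lambda>X _. X x)"
proof -
  have "length w = count_list w x" if "w \<in> lists {x}" for w
    using that by (induction w) auto
  then show ?thesis
    by (auto simp: processor_computes_def total_output_unit_emission splitter_def)
qed

text \<open>A toppler counts modulo \<open>l\<close> and emits the carries, so state and output are
  remainder and quotient of one division.\<close>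

lemma toppler_word:
  assumes "s < l" "w \<in> lists {x}"
  shows "final_state (toppler l q x y) s w = (s + length w) mod l"
    and "total_output (toppler l q x y) s w b = (s + length w) div l"
proof -
  have *: "final_state (toppler l q x y) s w = (s + length w) mod l \<and>
    total_output (toppler l q x y) s w b = (s + length w) div l" if "s < l" for s
    using assms(2) that
  proof (induction w arbitrary: s)
    case (Cons a w)
    show ?case
    proof (cases "s < l - 1")
      case True
      then show ?thesis using Cons.IH[of "s + 1"] by (simp add: toppler_def)
    next
      case False
      \<comment> \<open>Here \<open>s = l - 1\<close>: the letter completes a full count, which is
        emitted, and the rest of the word starts from state 0.\<close>
      then have eq: "s + length (a # w) = length w + l" using Cons.prems by simp
      have "(s + length (a # w)) mod l = length w mod l"
        "(s + length (a # w)) div l = Suc (length w div l)"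
        unfolding eq using Cons.prems div_add_self2[of l "length w"] by simp_all
      moreover have "final_state (toppler l q x y) s (a # w) = final_state (toppler l q x y) 0 w"
        "total_output (toppler l q x y) s (a # w) b = Suc (total_output (toppler l q x y) 0 w b)"
        using False by (simp_all add: toppler_def)
      ultimately show ?thesis using Cons.IH[of 0] Cons.prems by (simp only:) simp
    qed
  qed simp
  from *[OF assms(1)]
  show "final_state (toppler l q x y) s w = (s + length w) mod l"
    "total_output (toppler l q x y) s w b = (s + length w) div l" by blast+
qed

lemma abelian_toppler:
  assumes "q < l"
  shows "finite_abelian_processor (toppler l q x y)"
proof
  fix s assume "s \<in> states (toppler l q x y)"
  then have "s < l" by (simp add: toppler_def)
  \<comment> \<open>The summand \<open>l\<close> keeps the subtraction exact when
    \<open>q > s\<close> and disappears modulo \<open>l\<close>.\<close>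
  have w: "replicate (l + s - q) x \<in> lists {x}" by auto
  have "final_state (toppler l q x y) q (replicate (l + s - q) x) = s"
    using toppler_word(1)[OF assms w] assms \<open>s < l\<close> by simp
  then show "\<exists>w\<in>lists (inputs (toppler l q x y)).
      final_state (toppler l q x y) (initial (toppler l q x y)) w = s"
    using w by (intro bexI[of _ "replicate (l + s - q) x"]) (simp_all add: toppler_def)
qed (use assms in \<open>auto simp: toppler_def\<close>)

lemma computes_toppler:
  assumes "q < l"
  shows "processor_computes (toppler l q x y) (\<lambda>X _. (X x + q) div l)"
proof -
  have "length w = count_list w x" if "w \<in> lists {x}" for w
    using that by (induction w) auto
  moreover have "initial (toppler l q x y) = q" "inputs (toppler l q x y) = {x}"
    by (simp_all add: toppler_def)
  ultimately show ?thesis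
    using toppler_word(2)[OF assms] unfolding processor_computes_def
    by (metis add.commute singletonI)
qed

lemma is_gate_adder: "x \<noteq> y \<Longrightarrow> is_gate (adder x y z)"
  using computes_adder[of x y z]
  by (auto simp: is_gate_def is_adder_def adder_def)

lemma is_gate_splitter: "y \<noteq> z \<Longrightarrow> is_gate (splitter x y z)"
  using computes_splitter[of x y z]
  by (auto simp: is_gate_def is_splitter_def splitter_def)

lemma is_gate_toppler: "2 \<le> l \<Longrightarrow> q < l \<Longrightarrow> is_gate (toppler l q x y)"
  by (auto simp: is_gate_def is_toppler_def toppler_def)

lemma response_adder: "x \<noteq> y \<Longrightarrow> response (adder x y z) X z = X x + X y"
  using finite_abelian_processor.response_eqI[OF abelian_adder computes_adder, of x y z z X]
  by (simp add: adder_def)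

lemma response_splitter: "e \<in> {y, z} \<Longrightarrow> response (splitter x y z) X e = X x"
  using finite_abelian_processor.response_eqI[OF abelian_splitter computes_splitter, of e x y z X]
  by (simp add: splitter_def)

lemma response_toppler: "q < l \<Longrightarrow> response (toppler l q x y) X y = (X x + q) div l"
  by (rule finite_abelian_processor.response_eqI[OF abelian_toppler computes_toppler])
    (simp_all add: toppler_def)


section \<open>Acyclic networks\<close>

text \<open>\<open>V\<close> is a solution of the flow equations on the edges. By
  \<open>edge_order\<close> each equation refers only to smaller edges, so well-founded induction on
  the edge order replaces induction along the graph.\<close>

locale valued_network = abelian_network N
  for N :: "('v, 'e::wellorder, 'q) network" +
  fixes x :: "'e \<Rightarrow> nat" and V :: "'e \<Rightarrow> nat"
  assumes edge_order:
      "\<And>v a e. v \<in> nodes N \<Longrightarrow> a \<in> inputs (node_processor N v) \<Longrightarrow>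
        e \<in> outputs (node_processor N v) \<Longrightarrow> a < e"
    and value_input: "\<And>e. e \<in> input_edges N \<Longrightarrow> V e = x e"
    and value_tail: "\<And>e v. e \<in> edges N \<Longrightarrow> tail N e = Some v \<Longrightarrow>
        V e = response (node_processor N v) V e"
    and value_no_tail: "\<And>e. e \<in> output_edges N \<Longrightarrow> tail N e = None \<Longrightarrow> V e = 0"
begin

text \<open>All letters ever placed on \<open>e\<close> are counted, waiting or already consumed;
  letters on input edges count from the start. The case \<open>None\<close> serves output edges
  without tail.\<close>

definition supplied :: "('e \<Rightarrow> nat) \<Rightarrow> 'e \<Rightarrow> nat" where
  "supplied k e = (if e \<in> input_edges N then x e
    else case tail N e of Some v \<Rightarrow> response (node_processor N v) k e | None \<Rightarrow> 0)"

text \<open>Here \<open>k e\<close> is the number of letters that have been fed into the node at the head of \<open>e\<close>.\<close>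

definition consistent :: "('e \<Rightarrow> nat) \<Rightarrow> ('v, 'e, 'q) config \<Rightarrow> bool" where
  "consistent k C \<longleftrightarrow>
    (\<forall>e\<in>output_edges N \<union> trash_edges N. k e = 0) \<and>
    (\<forall>v\<in>nodes N. fst C v = state_after (node_processor N v) k) \<and>
    (\<forall>e\<in>edges N. snd C e + k e = supplied k e)"

lemma tail_cases:
  assumes "e \<in> edges N" "e \<notin> input_edges N"
  obtains (node) v where "v \<in> nodes N" "tail N e = Some v" "e \<in> outputs (node_processor N v)"
  | (none) "e \<in> output_edges N" "tail N e = None"
  using assms tail_node[of e] output_tail_node[of e] node_outputs
  by (cases "tail N e") auto

lemma consumed_edge:
  assumes "v \<in> nodes N" "a \<in> inputs (node_processor N v)"
  shows "a \<in> edges N - (output_edges N \<union> trash_edges N)"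
  using assms node_inputs output_trash_no_head by force

lemma supplied_value:
  assumes "e \<in> edges N"
  shows "supplied V e = V e"
proof (cases "e \<in> input_edges N")
  case False
  from assms False show ?thesis
  proof (cases rule: tail_cases)
    case (node v)
    then show ?thesis
      using value_tail[OF assms node(2)] False by (simp add: supplied_def)
  next
    case none
    then show ?thesis using value_no_tail False by (simp add: supplied_def)
  qed
qed (simp add: supplied_def value_input)

lemma supplied_cong:
  assumes "e \<in> edges N" "\<And>a. a \<in> edges N - (output_edges N \<union> trash_edges N) \<Longrightarrow> a < e \<Longrightarrow> k a = k' a"
  shows "supplied k e = supplied k' e"
proof (cases "e \<in> input_edges N")
  case False
  from assms(1) False show ?thesis
  proof (cases rule: tail_cases)
    case (node v)
    have "response (node_processor N v) k e = response (node_processor N v) k' e"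
      using node assms(2) edge_order consumed_edge
      by (intro finite_abelian_processor.result_cong(2)[OF node_processor]) blast+
    then show ?thesis using node False by (simp add: supplied_def)
  qed (simp add: supplied_def)
qed (simp add: supplied_def)

lemma supplied_mono:
  assumes "e \<in> edges N" "\<And>a. a \<in> edges N - (output_edges N \<union> trash_edges N) \<Longrightarrow> a < e \<Longrightarrow> k a \<le> k' a"
  shows "supplied k e \<le> supplied k' e"
proof (cases "e \<in> input_edges N")
  case False
  from assms(1) False show ?thesis
  proof (cases rule: tail_cases)
    case (node v)
    have "response (node_processor N v) k e \<le> response (node_processor N v) k' e"
      using node assms(2) edge_order consumed_edge
      by (intro finite_abelian_processor.response_mono[OF node_processor]) blast+
    then show ?thesis using node False by (simp add: supplied_def)
  qed (simp add: supplied_def)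
qed (simp add: supplied_def)

section \<open>Conservation of letters during a run\<close>

lemma consistent_initial: "consistent (\<lambda>_. 0) (initial_config N x)"
  unfolding consistent_def
proof (intro conjI ballI)
  fix e assume e: "e \<in> edges N"
  show "snd (initial_config N x) e + 0 = supplied (\<lambda>_. 0) e"
  proof (cases "e \<in> input_edges N")
    case False
    from e False show ?thesis
      using finite_abelian_processor.result_zero(2)[OF node_processor] False
      by (cases rule: tail_cases) (simp_all add: supplied_def initial_config_def)
  qed (simp add: supplied_def initial_config_def)
qed (simp_all add: initial_config_def finite_abelian_processor.result_zero(1)[OF node_processor])

text \<open>Feeding a letter from \<open>e\<close> into its head \<open>v\<close> raises
  \<open>k\<close> at \<open>e\<close> only. As \<open>e\<close> is an input of no other node, only
  \<open>v\<close> changes its state and its total output, by one transition and one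
  emission.\<close>

lemma consistent_step:
  assumes "consistent k C" "network_step N C C'"
  shows "\<exists>e\<in>edges N. consistent (k(e := Suc (k e))) C'"
  using assms(2)
proof cases
  case (1 e c v s)
  let ?k = "k(e := Suc (k e))"
  have e: "e \<in> edges N" and e': "e \<notin> output_edges N" "e \<notin> trash_edges N" using 1 by auto
  have v: "v \<in> nodes N" using head_node[of e] 1 by auto
  have e_in: "e \<in> inputs (node_processor N v)" using node_inputs[OF v] e 1 by simp
  have e_notin: "e \<notin> inputs (node_processor N u)" if "u \<in> nodes N" "u \<noteq> v" for u
    using node_inputs[OF that(1)] that(2) 1 by simp
  note letter = finite_abelian_processor.result_add_letter[OF node_processor[OF v] e_in]
  have other: "state_after (node_processor N u) ?k = state_after (node_processor N u) k"
    "f \<in> outputs (node_processor N u) \<Longrightarrow>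
      response (node_processor N u) ?k f = response (node_processor N u) k f"
    if "u \<in> nodes N" "u \<noteq> v" for u f
    using e_notin[OF that]
    by (auto intro!: finite_abelian_processor.result_cong[OF node_processor[OF that(1)]])
  have s: "s u = state_after (node_processor N u) k" if "u \<in> nodes N" for u
    using assms(1) that 1 by (simp add: consistent_def)
  have sup: "supplied ?k f = supplied k f + (if f \<in> edges N \<and> tail N f = Some v
      then emission (node_processor N v) e (s v) f else 0)" if f: "f \<in> edges N" for f
  proof (cases "f \<in> input_edges N")
    case False
    from f False show ?thesis
    proof (cases rule: tail_cases)
      case (node u)
      then show ?thesis
        using f False other letter(2) s[OF v] by (cases "u = v") (simp_all add: supplied_def)
    qed (simp add: supplied_def)
  qed (simp add: supplied_def input_no_tail)
  have "consistent ?k C'"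
    unfolding consistent_def
  proof (intro conjI ballI)
    fix f assume "f \<in> output_edges N \<union> trash_edges N"
    then show "?k f = 0" using e' assms(1) by (auto simp: consistent_def)
  next
    fix u assume u: "u \<in> nodes N"
    then show "fst C' u = state_after (node_processor N u) ?k"
      using 1 s letter(1) other(1) by (cases "u = v") simp_all
  next
    fix f assume f: "f \<in> edges N"
    have "c f + k f = supplied k f" using assms(1) f 1 by (simp add: consistent_def)
    then show "snd C' f + ?k f = supplied ?k f"
      using 1 sup[OF f] by auto
  qed
  then show ?thesis using e by blast
qed

text \<open>What was consumed was supplied before, and the supply is a monotone function of the
  consumption on smaller edges.\<close>

lemma consistent_le:
  assumes "consistent k C" "e \<in> edges N"
  shows "k e \<le> V e"
  using assms(2)
proof (induction e rule: less_induct)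
  case (less e)
  have "snd C e + k e = supplied k e"
    using assms(1) less.prems unfolding consistent_def by blast
  then have "k e \<le> supplied k e" by simp
  also have "\<dots> \<le> supplied V e" using less by (intro supplied_mono) auto
  finally show ?case using supplied_value less.prems by simp
qed

lemma halts: "halts_on N x"
  unfolding halts_on_def
proof
  assume "\<exists>C. C 0 = initial_config N x \<and> (\<forall>n::nat. network_step N (C n) (C (Suc n)))"
  then obtain C where C: "C 0 = initial_config N x" "\<And>n::nat. network_step N (C n) (C (Suc n))"
    by blast
  have *: "\<exists>k. consistent k (C n) \<and> (\<Sum>e\<in>edges N. k e) = n" for n
  proof (induction n)
    case 0
    then show ?case using consistent_initial C(1) by (intro exI[of _ "\<lambda>_. 0"]) simp
  next
    case (Suc n)
    then obtain k where k: "consistent k (C n)" "(\<Sum>e\<in>edges N. k e) = n" by blast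
    obtain e where e: "e \<in> edges N" "consistent (k(e := Suc (k e))) (C (Suc n))"
      using consistent_step[OF k(1) C(2)] by blast
    moreover have "(\<Sum>f\<in>edges N. (k(e := Suc (k e))) f) = Suc n"
      using k(2) e(1) finite_edges
      by (simp add: sum.remove[OF finite_edges e(1)])
    ultimately show ?case by blast
  qed
  \<comment> \<open>Each step consumes exactly one letter, so one step more than the total of
    \<open>V\<close> contradicts the bound.\<close>
  obtain k where k: "consistent k (C (Suc (\<Sum>e\<in>edges N. V e)))"
    "(\<Sum>e\<in>edges N. k e) = Suc (\<Sum>e\<in>edges N. V e)"
    using * by blast
  have "(\<Sum>e\<in>edges N. k e) \<le> (\<Sum>e\<in>edges N. V e)"
    using consistent_le[OF k(1)] by (rule sum_mono)
  then show False using k(2) by simp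
qed

lemma halted_output:
  assumes "(network_step N)\<^sup>*\<^sup>* (initial_config N x) C" "halted N C" "e \<in> output_edges N"
  shows "snd C e = V e"
proof -
  have "\<exists>k. consistent k C"
    using assms(1)
  proof (induction rule: rtranclp_induct)
    case base
    show ?case by (rule exI, rule consistent_initial)
  next
    case (step C C')
    then show ?case using consistent_step by blast
  qed
  then obtain k where k: "consistent k C" by (rule exE)
  \<comment> \<open>After halting, each edge that feeds a node is empty, so there \<open>k\<close>
    equals its own supply and solves the same recursion as \<open>V\<close>. Output edges have
    \<open>k e = 0\<close>: their whole supply still lies on them.\<close>
  have supplied: "supplied k f = V f" if "f \<in> edges N" for f
    using that
  proof (induction f rule: less_induct)
    case (less f)
    have "k a = V a" if "a \<in> edges N - (output_edges N \<union> trash_edges N)" "a < f" for a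
      using less.IH[of a] that assms(2) k by (auto simp: halted_def consistent_def)
    then show ?case
      using supplied_cong[of f k V] supplied_value less.prems by simp
  qed
  have "e \<in> edges N" using dangling_subset assms(3) by blast
  then show ?thesis using k supplied assms(3) by (auto simp: consistent_def)
qed

end


section \<open>Networks of gates\<close>

text \<open>\<open>V e x\<close> is the number of letters that traverse the edge \<open>e\<close> on input \<open>x\<close>.\<close>

definition gate_network ::
  "(nat, nat, nat) network \<Rightarrow> (nat \<Rightarrow> (nat \<Rightarrow> nat) \<Rightarrow> nat) \<Rightarrow> bool" where
  "gate_network N V \<longleftrightarrow> (\<forall>x. valued_network N x (\<lambda>e. V e x)) \<and>
    (\<forall>v\<in>nodes N. is_gate (node_processor N v)) \<and>
    (\<forall>e\<in>edges N. \<forall>u v. tail N e = Some u \<longrightarrow> head N e = Some v \<longrightarrow> u < v)"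

lemma gate_network_acyclic:
  assumes "gate_network N V"
  shows "directed_acyclic N"
proof -
  have "{(u, v). \<exists>e\<in>edges N. tail N e = Some u \<and> head N e = Some v} \<subseteq> less_than"
    using assms by (auto simp: gate_network_def)
  then show ?thesis
    unfolding directed_acyclic_def using wf_less_than wf_subset wf_acyclic by blast
qed

lemma gate_network_computes:
  assumes "gate_network N V"
  shows "network_computes N (\<lambda>x e. V e x)"
  unfolding network_computes_def
  using assms valued_network.halts valued_network.halted_output
  unfolding gate_network_def by blast

text \<open>An input edge must end in a node, so a variable becomes an unread wire only behind a
  gate. A splitter preserves the count and leaves two copies.\<close>

definition base_network :: "nat \<Rightarrow> (nat, nat, nat) network" where
  "base_network n = \<lparr>nodes = {..<n}, edges = {..<3 * n},
    tail = \<lambda>e. if e < n \<or> 3 * n \<le> e then None else if e < 2 * n then Some (e - n) else Some (e - 2 * n),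
    head = \<lambda>e. if e < n then Some e else None,
    input_edges = {..<n}, output_edges = {}, trash_edges = {n..<3 * n},
    node_processor = \<lambda>v. splitter v (n + v) (2 * n + v)\<rparr>"

lemma gate_network_base:
  "gate_network (base_network n)
    (\<lambda>e x. if e < n then x e else if e < 2 * n then x (e - n) else x (e - 2 * n))"
  unfolding gate_network_def
proof (intro conjI allI ballI impI)
  fix x
  show "valued_network (base_network n) x
     (\<lambda>e. if e < n then x e else if e < 2 * n then x (e - n) else x (e - 2 * n))"
  proof (intro valued_network.intro abelian_network.intro valued_network_axioms.intro)
    fix v assume "v \<in> nodes (base_network n)"
    then show "finite_abelian_processor (node_processor (base_network n) v)"
      by (simp add: base_network_def abelian_splitter)
  next
    fix e v
    assume "e \<in> edges (base_network n)" "tail (base_network n) e = Some v"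
    then have "v < n" "e = n + v \<or> e = 2 * n + v"
      by (auto simp: base_network_def split: if_splits)
    then show "(if e < n then x e else if e < 2 * n then x (e - n) else x (e - 2 * n)) =
      response (node_processor (base_network n) v)
        (\<lambda>e. if e < n then x e else if e < 2 * n then x (e - n) else x (e - 2 * n)) e"
      by (auto simp: base_network_def response_splitter)
  qed (auto simp: base_network_def splitter_def split: if_splits)
qed (auto simp: base_network_def is_gate_splitter split: if_splits)

section \<open>Growing a network by one gate\<close>

definition add_node ::
  "(nat, nat, nat) network \<Rightarrow> nat \<Rightarrow> (nat, nat, nat) processor \<Rightarrow> (nat, nat, nat) network" where
  "add_node N k P = \<lparr>nodes = insert k (nodes N), edges = edges N \<union> outputs P,
    tail = \<lambda>e. if e \<in> outputs P then Some k else tail N e,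
    head = \<lambda>e. if e \<in> outputs P then None else if e \<in> inputs P then Some k else head N e,
    input_edges = input_edges N, output_edges = output_edges N,
    trash_edges = trash_edges N - inputs P \<union> outputs P,
    node_processor = (node_processor N)(k := P)\<rparr>"

text \<open>The new gate reads only trash edges, which fed no node before, and writes only fresh
  edges, so all old flow equations persist. Placing \<open>k\<close> and \<open>outputs P\<close>
  above everything old preserves both orders.\<close>

lemma gate_network_add_node:
  assumes net: "gate_network N V"
    and P: "finite_abelian_processor P" "is_gate P"
    and ins: "inputs P \<subseteq> trash_edges N"
    and outs: "\<And>e a. e \<in> outputs P \<Longrightarrow> a \<in> edges N \<Longrightarrow> a < e"
    and k: "\<And>v. v \<in> nodes N \<Longrightarrow> v < k"
  shows "gate_network (add_node N k P)
    (\<lambda>e x. if e \<in> outputs P then response P (\<lambda>a. V a x) e else V e x)"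
  unfolding gate_network_def
proof (intro conjI allI ballI impI)
  let ?N = "add_node N k P"
  have fresh: "e \<notin> edges N" if "e \<in> outputs P" for e using outs[OF that] by blast
  have fresh_k: "k \<notin> nodes N" using k by blast
  have abelian: "abelian_network N"
    using net unfolding gate_network_def valued_network_def by blast
  interpret N: abelian_network N by (rule abelian)
  have dangling: "input_edges N \<subseteq> edges N" "output_edges N \<subseteq> edges N" "trash_edges N \<subseteq> edges N"
    using N.dangling_subset by auto
  have io: "inputs P \<inter> outputs P = {}" using ins dangling fresh by blast
  have io_old: "inputs (node_processor N v) \<subseteq> edges N" "outputs (node_processor N v) \<subseteq> edges N"
    if "v \<in> nodes N" for v
    using N.node_inputs[OF that] N.node_outputs[OF that] by auto
  fix x
  let ?V = "\<lambda>e. if e \<in> outputs P then response P (\<lambda>a. V a x) e else V e x"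
  interpret V: valued_network N x "\<lambda>e. V e x"
    using net by (simp add: gate_network_def)
  have head_old: "head N e = Some v \<Longrightarrow> e \<in> edges N \<Longrightarrow> v \<in> nodes N" for e v
    using N.head_node[of e] N.output_trash_no_head[of e] by force
  have tail_old: "tail N e = Some v \<Longrightarrow> e \<in> edges N \<Longrightarrow> v \<in> nodes N" for e v
    using N.tail_node[of e] N.output_tail_node[of e] N.input_no_tail[of e] by force
  show "valued_network ?N x ?V"
  proof (intro valued_network.intro abelian_network.intro valued_network_axioms.intro)
    show "finite (nodes ?N)" "finite (edges ?N)"
      using N.finite_nodes N.finite_edges finite_abelian_processor.finite_outputs[OF P(1)]
      by (simp_all add: add_node_def)
    show "input_edges ?N \<union> output_edges ?N \<union> trash_edges ?N \<subseteq> edges ?N"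
      using dangling by (auto simp: add_node_def)
    show "input_edges ?N \<inter> output_edges ?N = {}" "input_edges ?N \<inter> trash_edges ?N = {}"
      "output_edges ?N \<inter> trash_edges ?N = {}"
      using N.dangling_disjoint dangling fresh by (auto simp: add_node_def)
    show "tail ?N e = None" if "e \<in> input_edges ?N" for e
      using that N.input_no_tail dangling fresh by (auto simp: add_node_def)
    show "head ?N e = None" if "e \<in> output_edges ?N \<union> trash_edges ?N" for e
      using that N.output_trash_no_head N.dangling_disjoint ins by (auto simp: add_node_def)
    show "\<exists>v\<in>nodes ?N. head ?N e = Some v"
      if "e \<in> edges ?N - (output_edges ?N \<union> trash_edges ?N)" for e
      using that N.head_node[of e] by (auto simp: add_node_def)
    show "\<exists>v\<in>nodes ?N. tail ?N e = Some v"
      if "e \<in> edges ?N - (input_edges ?N \<union> output_edges ?N)" for e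
      using that N.tail_node[of e] by (auto simp: add_node_def)
    show "v \<in> nodes ?N" if "e \<in> output_edges ?N" "tail ?N e = Some v" for e v
      using that N.output_tail_node by (auto simp: add_node_def split: if_splits)
    show "finite_abelian_processor (node_processor ?N v)" if "v \<in> nodes ?N" for v
      using that N.node_processor P(1) by (auto simp: add_node_def)
    show "inputs (node_processor ?N v) = {e \<in> edges ?N. head ?N e = Some v}" if "v \<in> nodes ?N" for v
    proof (cases "v = k")
      case True
      then show ?thesis
        using ins dangling fresh io head_old fresh_k by (auto simp: add_node_def split: if_splits)
    next
      case False
      then have "v \<in> nodes N" using that by (simp add: add_node_def)
      then show ?thesis
        using False N.node_inputs fresh ins N.output_trash_no_head
        by (force simp: add_node_def split: if_splits)
    qed
    show "outputs (node_processor ?N v) = {e \<in> edges ?N. tail ?N e = Some v}" if "v \<in> nodes ?N" for v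
    proof (cases "v = k")
      case True
      then show ?thesis
        using tail_old fresh_k by (auto simp: add_node_def split: if_splits)
    next
      case False
      then have "v \<in> nodes N" using that by (simp add: add_node_def)
      then show ?thesis
        using False N.node_outputs fresh by (auto simp: add_node_def split: if_splits)
    qed
    show "a < e" if "v \<in> nodes ?N" "a \<in> inputs (node_processor ?N v)"
      "e \<in> outputs (node_processor ?N v)" for v a e
      using that V.edge_order[of v a e] outs[of e a] ins dangling
      by (auto simp: add_node_def split: if_splits)
    show "?V e = x e" if "e \<in> input_edges ?N" for e
      using that V.value_input dangling fresh by (auto simp: add_node_def)
    show "?V e = response (node_processor ?N v) ?V e"
      if "e \<in> edges ?N" "tail ?N e = Some v" for e v
    proof (cases "e \<in> outputs P")
      case True
      then have "v = k" using that by (simp add: add_node_def)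
      \<comment> \<open>The gate does not read its own outputs, so extending \<open>V\<close> to
        them leaves its arguments unchanged.\<close>
      moreover have "response P (\<lambda>a. V a x) e = response P ?V e"
        using io True by (intro finite_abelian_processor.result_cong(2)[OF P(1)]) auto
      ultimately show ?thesis using True by (simp add: add_node_def)
    next
      case False
      then have e: "e \<in> edges N" "tail N e = Some v" using that by (auto simp: add_node_def)
      then have v: "v \<in> nodes N" "v \<noteq> k" using tail_old fresh_k by auto
      have "e \<in> outputs (node_processor N v)" using N.node_outputs v e by simp
      then have "response (node_processor N v) (\<lambda>a. V a x) e = response (node_processor N v) ?V e"
        using io_old(1)[OF v(1)] fresh
        by (intro finite_abelian_processor.result_cong(2)[OF N.node_processor[OF v(1)]]) auto
      then show ?thesis using V.value_tail[OF e] False v by (simp add: add_node_def)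
    qed
    show "?V e = 0" if "e \<in> output_edges ?N" "tail ?N e = None" for e
      using that V.value_no_tail by (auto simp: add_node_def split: if_splits)
  qed
next
  let ?N = "add_node N k P"
  show "is_gate (node_processor ?N v)" if "v \<in> nodes ?N" for v
    using that net P(2) by (auto simp: add_node_def gate_network_def)
  have abelian: "abelian_network N"
    using net unfolding gate_network_def valued_network_def by blast
  interpret N: abelian_network N by (rule abelian)
  show "u < v" if "e \<in> edges ?N" "tail ?N e = Some u" "head ?N e = Some v" for e u v
  proof -
    have e: "e \<notin> outputs P" "e \<in> edges N" "tail N e = Some u"
      using that by (auto simp: add_node_def split: if_splits)
    then have "u \<in> nodes N"
      using N.tail_node[of e] N.output_tail_node[of e] N.input_no_tail[of e] by force
    then show ?thesis
      using e that net k by (auto simp: add_node_def gate_network_def split: if_splits)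
  qed
qed

text \<open>Functions that are no longer needed are left in the trash.\<close>

definition available :: "nat \<Rightarrow> ((nat \<Rightarrow> nat) \<Rightarrow> nat) list \<Rightarrow> bool" where
  "available n fs \<longleftrightarrow> (\<exists>N V ws. gate_network N V \<and> input_edges N = {..<n} \<and>
    output_edges N = {} \<and> distinct ws \<and> set ws \<subseteq> trash_edges N \<and> map V ws = fs)"

section \<open>Wiring formulas from a stock of unread wires\<close>

lemma available_variables: "available n (map (\<lambda>i x. x i) [0..<n])"
  unfolding available_def
proof (intro exI conjI)
  show "gate_network (base_network n)
    (\<lambda>e x. if e < n then x e else if e < 2 * n then x (e - n) else x (e - 2 * n))"
    by (rule gate_network_base)
  \<comment> \<open>Only the first output of each splitter is listed; its twin stays in the
    trash.\<close>
  show "distinct (map ((+) n) [0..<n])" by (simp add: distinct_map)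
  show "map (\<lambda>e x. if e < n then x e else if e < 2 * n then x (e - n) else x (e - 2 * n))
      (map ((+) n) [0..<n]) = map (\<lambda>i x. x i) [0..<n]"
    by (auto simp: fun_eq_iff)
qed (auto simp: base_network_def)

text \<open>The stock is really a multiset; this lets every gate act at the front of the
  list.\<close>

lemma available_permute:
  assumes "available n fs" "mset fs = mset gs"
  shows "available n gs"
proof -
  obtain N V ws where N: "gate_network N V" "input_edges N = {..<n}" "output_edges N = {}"
    "distinct ws" "set ws \<subseteq> trash_edges N" "map V ws = fs"
    using assms(1) unfolding available_def by blast
  obtain p where p: "p permutes {..<length fs}" "permute_list p fs = gs"
    using mset_eq_permutation[OF assms(2)[symmetric]] by blast
  have "length ws = length fs" using N(6) by auto
  then have "map V (permute_list p ws) = gs" "distinct (permute_list p ws)"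
    "set (permute_list p ws) = set ws"
    using p N(4,6) by (auto simp: permute_list_map[symmetric])
  then show ?thesis
    unfolding available_def using N by metis
qed

lemma available_drop:
  assumes "available n (fs @ gs)"
  shows "available n gs"
proof -
  obtain N V ws where N: "gate_network N V" "input_edges N = {..<n}" "output_edges N = {}"
    "distinct ws" "set ws \<subseteq> trash_edges N" "map V ws = fs @ gs"
    using assms unfolding available_def by blast
  then have "map V (drop (length fs) ws) = gs" by (simp add: drop_map[symmetric])
  moreover have "set (drop (length fs) ws) \<subseteq> trash_edges N"
    using N(5) set_drop_subset by fastforce
  ultimately show ?thesis
    unfolding available_def using N distinct_drop by blast
qed

text \<open>\<open>G\<close> describes the gate on lists of values, so that one construction serves
  all three gates. The gate is demanded for all \<open>ws\<close> and \<open>m\<close> because its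
  edges are known only once the network is chosen; \<open>m\<close> is taken above all existing
  edges.\<close>

lemma available_gate:
  assumes "available n (fs @ hs)"
    and gate: "\<And>ws m. distinct ws \<Longrightarrow> length ws = length fs \<Longrightarrow> \<exists>P. finite_abelian_processor P \<and>
      is_gate P \<and> inputs P = set ws \<and> outputs P = {m..<m + length gs} \<and>
      (\<forall>y. map (response P y) [m..<m + length gs] = G (map y ws))"
    and gs: "\<And>x. map (\<lambda>g. g x) gs = G (map (\<lambda>f. f x) fs)"
  shows "available n (gs @ hs)"
proof -
  obtain N V ws where N: "gate_network N V" "input_edges N = {..<n}" "output_edges N = {}"
    "distinct ws" "set ws \<subseteq> trash_edges N" "map V ws = fs @ hs"
    using assms unfolding available_def by blast
  have "abelian_network N"
    using N(1) unfolding gate_network_def valued_network_def by blast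
  then interpret N: abelian_network N .
  obtain us vs where ws: "ws = us @ vs" "map V us = fs" "map V vs = hs"
    using N(6) by (auto simp: map_eq_append_conv)
  obtain m where m: "\<And>e. e \<in> edges N \<Longrightarrow> e < m"
    using N.finite_edges unfolding finite_nat_set_iff_bounded by blast
  obtain k where k: "\<And>v. v \<in> nodes N \<Longrightarrow> v < k"
    using N.finite_nodes unfolding finite_nat_set_iff_bounded by blast
  have "distinct us" "length us = length fs" using N(4) ws by auto
  from gate[OF this] obtain P where P: "finite_abelian_processor P" "is_gate P"
    "inputs P = set us" "outputs P = {m..<m + length gs}"
    "\<And>y. map (response P y) [m..<m + length gs] = G (map y us)"
    by metis
  let ?V = "\<lambda>e x. if e \<in> outputs P then response P (\<lambda>a. V a x) e else V e x"
  have vs_old: "e < m" if "e \<in> set vs" for e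
    using that N(5) ws(1) N.dangling_subset m by auto
  show ?thesis
    unfolding available_def
  proof (intro exI conjI)
    show "gate_network (add_node N k P) ?V"
      using N(1,5) P m k ws by (intro gate_network_add_node) fastforce+
    show "input_edges (add_node N k P) = {..<n}" "output_edges (add_node N k P) = {}"
      using N(2,3) by (simp_all add: add_node_def)
    show "distinct ([m..<m + length gs] @ vs)"
      using vs_old N(4) ws(1) by force
    show "set ([m..<m + length gs] @ vs) \<subseteq> trash_edges (add_node N k P)"
      using N(4,5) ws(1) P(3,4) by (auto simp: add_node_def)
    have "map ?V vs = hs"
      using vs_old P(4) unfolding ws(3)[symmetric] by (intro map_cong) force+
    moreover have "map ?V [m..<m + length gs] = gs"
    proof (rule nth_equalityI)
      fix i assume i: "i < length (map ?V [m..<m + length gs])"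
      show "map ?V [m..<m + length gs] ! i = gs ! i"
      proof
        fix x
        have "map (response P (\<lambda>a. V a x)) [m..<m + length gs] = map (\<lambda>g. g x) gs"
          using P(5)[of "\<lambda>a. V a x"] gs[of x] ws(2) by (auto simp: comp_def)
        from arg_cong[OF this, of "\<lambda>l. l ! i"]
        show "(map ?V [m..<m + length gs] ! i) x = (gs ! i) x"
          using i P(4) by simp
      qed
    qed simp
    ultimately show "map ?V ([m..<m + length gs] @ vs) = gs @ hs" by simp
  qed
qed

lemma available_add:
  assumes "available n (f # g # hs)"
  shows "available n ((\<lambda>x. f x + g x) # hs)"
proof -
  have "available n ([\<lambda>x. f x + g x] @ hs)"
  proof (rule available_gate[where fs = "[f, g]" and G = "\<lambda>ys. [ys ! 0 + ys ! 1]"])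
    fix ws :: "nat list" and m
    assume "distinct ws" "length ws = length [f, g]"
    then obtain u v where ws: "ws = [u, v]" "u \<noteq> v"
      by (auto simp: length_Suc_conv numeral_2_eq_2)
    show "\<exists>P. finite_abelian_processor P \<and> is_gate P \<and> inputs P = set ws \<and>
      outputs P = {m..<m + length [\<lambda>x. f x + g x]} \<and>
      (\<forall>y. map (response P y) [m..<m + length [\<lambda>x. f x + g x]] = [map y ws ! 0 + map y ws ! 1])"
      using abelian_adder[of u v m] is_gate_adder[of u v m] response_adder[of u v m] ws
      by (intro exI[of _ "adder u v m"]) (auto simp: adder_def)
  qed (use assms in auto)
  then show ?thesis by simp
qed

lemma available_split:
  assumes "available n (f # hs)"
  shows "available n (f # f # hs)"
proof -
  have "available n ([f, f] @ hs)"
  proof (rule available_gate[where fs = "[f]" and G = "\<lambda>ys. [ys ! 0, ys ! 0]"])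
    fix ws :: "nat list" and m
    assume "distinct ws" "length ws = length [f]"
    then obtain u where ws: "ws = [u]" by (auto simp: length_Suc_conv)
    show "\<exists>P. finite_abelian_processor P \<and> is_gate P \<and> inputs P = set ws \<and>
      outputs P = {m..<m + length [f, f]} \<and>
      (\<forall>y. map (response P y) [m..<m + length [f, f]] = [map y ws ! 0, map y ws ! 0])"
      using abelian_splitter[of u m "m + 1"] is_gate_splitter[of m "m + 1" u]
        response_splitter[of _ m "m + 1" u] ws
      by (intro exI[of _ "splitter u m (m + 1)"]) (auto simp: splitter_def)
  qed (use assms in auto)
  then show ?thesis by simp
qed

lemma available_topple:
  assumes "available n (f # hs)" "2 \<le> l" "q < l"
  shows "available n ((\<lambda>x. (f x + q) div l) # hs)"
proof -
  have "available n ([\<lambda>x. (f x + q) div l] @ hs)"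
  proof (rule available_gate[where fs = "[f]" and G = "\<lambda>ys. [(ys ! 0 + q) div l]"])
    fix ws :: "nat list" and m
    assume "distinct ws" "length ws = length [f]"
    then obtain u where ws: "ws = [u]" by (auto simp: length_Suc_conv)
    show "\<exists>P. finite_abelian_processor P \<and> is_gate P \<and> inputs P = set ws \<and>
      outputs P = {m..<m + length [\<lambda>x. (f x + q) div l]} \<and>
      (\<forall>y. map (response P y) [m..<m + length [\<lambda>x. (f x + q) div l]] = [(map y ws ! 0 + q) div l])"
      using abelian_toppler[OF assms(3), of u m] is_gate_toppler[OF assms(2,3), of u m]
        response_toppler[OF assms(3), of u m] ws
      by (intro exI[of _ "toppler l q u m"]) (auto simp: toppler_def)
  qed (use assms in auto)
  then show ?thesis by simp
qed

text \<open>The variables are kept at the front as an invariant so that later subformulas can use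
  them again; the case of a variable is where a splitter makes the copy.\<close>

lemma available_gate_function:
  assumes "gate_function n f" "available n (map (\<lambda>i x. x i) [0..<n] @ fs)"
  shows "available n (map (\<lambda>i x. x i) [0..<n] @ f # fs)"
  using assms
proof (induction arbitrary: fs rule: gate_function.induct)
  case (variable i)
  let ?v = "\<lambda>i (x :: nat \<Rightarrow> nat). x i"
  have "[0..<n] = [0..<i] @ i # [Suc i..<n]"
    using variable.hyps by (metis le_add1 le_add_same_cancel1 less_imp_add_positive upt_add_eq_append upt_conv_Cons)
  then have *: "map ?v [0..<n] = map ?v [0..<i] @ ?v i # map ?v [Suc i..<n]" by simp
  have "available n (?v i # map ?v [0..<i] @ map ?v [Suc i..<n] @ fs)"
    by (rule available_permute[OF variable.prems]) (simp only: *, simp)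
  then have "available n (?v i # ?v i # map ?v [0..<i] @ map ?v [Suc i..<n] @ fs)"
    by (rule available_split)
  then show ?case
    by (rule available_permute) (simp only: *, simp)
next
  case (add f g)
  let ?vs = "map (\<lambda>i (x :: nat \<Rightarrow> nat). x i) [0..<n]"
  \<comment> \<open>The hypothesis for \<open>g\<close> is applied to \<open>fs\<close>, then the
    one for \<open>f\<close> to \<open>g # fs\<close>.\<close>
  have "available n (?vs @ f # g # fs)" using add by blast
  then have "available n (f # g # ?vs @ fs)" by (rule available_permute) simp
  then have "available n ((\<lambda>x. f x + g x) # ?vs @ fs)" by (rule available_add)
  then show ?case by (rule available_permute) simp
next
  case (topple f l q)
  let ?vs = "map (\<lambda>i (x :: nat \<Rightarrow> nat). x i) [0..<n]"
  have "available n (?vs @ f # fs)" using topple by blast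
  then have "available n (f # ?vs @ fs)" by (rule available_permute) simp
  then have "available n ((\<lambda>x. (f x + q) div l) # ?vs @ fs)"
    using topple.hyps by (intro available_topple)
  then show ?case by (rule available_permute) simp
qed

lemma available_gate_functions:
  assumes "\<And>f. f \<in> set fs \<Longrightarrow> gate_function n f"
  shows "available n fs"
proof -
  have "available n (map (\<lambda>i x. x i) [0..<n] @ fs)"
    using assms
    by (induction fs) (use available_variables in \<open>simp_all add: available_gate_function\<close>)
  then show ?thesis by (rule available_drop)
qed

text \<open>\<open>W\<close> consists of the wires promoted from trash to output; \<open>Z\<close>
  consists of new edges without tail for output letters that are never emitted.\<close>

definition select_outputs ::
  "(nat, nat, nat) network \<Rightarrow> nat set \<Rightarrow> nat set \<Rightarrow> (nat, nat, nat) network" where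
  "select_outputs N W Z = \<lparr>nodes = nodes N, edges = edges N \<union> Z,
    tail = \<lambda>e. if e \<in> Z then None else tail N e,
    head = \<lambda>e. if e \<in> Z then None else head N e,
    input_edges = input_edges N, output_edges = W \<union> Z,
    trash_edges = trash_edges N - W, node_processor = node_processor N\<rparr>"

lemma gate_network_select_outputs:
  assumes net: "gate_network N V" "output_edges N = {}"
    and W: "W \<subseteq> trash_edges N" and Z: "finite Z" "Z \<inter> edges N = {}"
  shows "gate_network (select_outputs N W Z) (\<lambda>e x. if e \<in> Z then 0 else V e x)"
  unfolding gate_network_def
proof (intro conjI allI ballI impI)
  let ?N = "select_outputs N W Z"
  have abelian: "abelian_network N"
    using net unfolding gate_network_def valued_network_def by blast
  interpret N: abelian_network N by (rule abelian)
  have dangling: "input_edges N \<subseteq> edges N" "trash_edges N \<subseteq> edges N"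
    using N.dangling_subset by auto
  fix x
  interpret V: valued_network N x "\<lambda>e. V e x"
    using net by (simp add: gate_network_def)
  let ?V = "\<lambda>e. if e \<in> Z then 0 else V e x"
  show "valued_network ?N x ?V"
  proof (intro valued_network.intro abelian_network.intro valued_network_axioms.intro)
    show "?V e = response (node_processor ?N v) ?V e"
      if "e \<in> edges ?N" "tail ?N e = Some v" for e v
    proof -
      have e: "e \<in> edges N" "e \<notin> Z" "tail N e = Some v"
        using that by (auto simp: select_outputs_def split: if_splits)
      then have v: "v \<in> nodes N" "e \<in> outputs (node_processor N v)"
        using N.tail_node[of e] N.input_no_tail[of e] N.node_outputs[of v] net(2) by auto
      have "response (node_processor N v) (\<lambda>a. V a x) e = response (node_processor N v) ?V e"
        using N.node_inputs[OF v(1)] Z(2) v(2)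
        by (intro finite_abelian_processor.result_cong(2)[OF N.node_processor[OF v(1)]]) auto
      then show ?thesis using V.value_tail[OF e(1,3)] e(2) by (simp add: select_outputs_def)
    qed
    show "?V e = 0" if "e \<in> output_edges ?N" "tail ?N e = None" for e
      using that N.tail_node[of e] N.dangling_disjoint W dangling net(2)
      by (auto simp: select_outputs_def split: if_splits)
    show "\<exists>v\<in>nodes ?N. head ?N e = Some v"
      if "e \<in> edges ?N - (output_edges ?N \<union> trash_edges ?N)" for e
      using that N.head_node[of e] net(2) Z(2) by (auto simp: select_outputs_def)
    show "\<exists>v\<in>nodes ?N. tail ?N e = Some v"
      if "e \<in> edges ?N - (input_edges ?N \<union> output_edges ?N)" for e
      using that N.tail_node[of e] net(2) by (auto simp: select_outputs_def)
    show "v \<in> nodes ?N" if "e \<in> output_edges ?N" "tail ?N e = Some v" for e v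
      using that N.tail_node[of e] N.dangling_disjoint W dangling net(2)
      by (auto simp: select_outputs_def split: if_splits)
    show "input_edges ?N \<inter> output_edges ?N = {}" "input_edges ?N \<inter> trash_edges ?N = {}"
      "output_edges ?N \<inter> trash_edges ?N = {}"
      using N.dangling_disjoint dangling W Z(2) by (auto simp: select_outputs_def)
    show "inputs (node_processor ?N v) = {e \<in> edges ?N. head ?N e = Some v}" if "v \<in> nodes ?N" for v
      using that N.node_inputs[of v] Z(2) by (auto simp: select_outputs_def split: if_splits)
    show "outputs (node_processor ?N v) = {e \<in> edges ?N. tail ?N e = Some v}" if "v \<in> nodes ?N" for v
      using that N.node_outputs[of v] Z(2) by (auto simp: select_outputs_def split: if_splits)
  qed (use N.finite_nodes N.finite_edges N.input_no_tail N.output_trash_no_head N.node_processor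
      V.edge_order V.value_input dangling W Z in \<open>auto simp: select_outputs_def\<close>)
qed (use net Z(2) in \<open>auto simp: select_outputs_def gate_network_def split: if_splits\<close>)


section \<open>Recurrent processors\<close>

lemma (in finite_abelian_processor) gate_function0_response:
  assumes "recurrent P" "bij_betw i (inputs P) {..<n}" "b \<in> outputs P"
  shows "gate_function0 n (\<lambda>x. response P (x \<circ> i) b)"
proof -
  obtain d where d: "d \<ge> 2" "\<And>a. a \<in> inputs P \<Longrightarrow> final_state P (initial P) (replicate d a) = initial P"
    using recurrent_common_period[OF assms(1)] by blast
  have i: "i a < n" if "a \<in> inputs P" for a
    using that assms(2) bij_betwE by blast
  show ?thesis
  proof (rule gate_function0_of_linear_periodic)
    show "n \<le> n" by simp
    show "depends_below n (\<lambda>x. response P (x \<circ> i) b)"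
      unfolding depends_below_def
      using i by (auto intro!: result_cong(2)[OF _ assms(3)])
    show "mono (\<lambda>x. response P (x \<circ> i) b)"
      by (intro monoI response_mono[OF _ assms(3)]) (simp add: le_fun_def)
    show "response P ((\<lambda>_. 0) \<circ> i) b = 0"
      using result_zero(2)[OF assms(3)] by (simp add: comp_def)
    show "2 \<le> d" by (rule d)
    show "linear_periodic n d (\<lambda>x. response P (x \<circ> i) b)"
      unfolding linear_periodic_def
    proof (intro allI impI)
      fix j assume "j < n"
      then obtain a where a: "a \<in> inputs P" "i a = j"
        using assms(2) by (metis bij_betw_iff_bijections lessThan_iff)
      have "response P (x(j := x j + d) \<circ> i) b =
          response P (x \<circ> i) b + total_output P (initial P) (replicate d a) b" for x
      proof -
        \<comment> \<open>Injectivity of \<open>i\<close> guarantees that shifting coordinate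
          \<open>j\<close> affects the count of the single letter \<open>a\<close>.\<close>
        have "(x(j := x j + d) \<circ> i) c = ((x \<circ> i)(a := (x \<circ> i) a + d)) c" if "c \<in> inputs P" for c
          using that a bij_betw_imp_inj_on[OF assms(2)] by (auto dest: inj_onD)
        then have "response P (x(j := x j + d) \<circ> i) b =
            response P ((x \<circ> i)(a := (x \<circ> i) a + d)) b"
          by (rule result_cong(2)[OF _ assms(3)])
        then show ?thesis
          using response_period[OF a(1) assms(3) d(2)[OF a(1)]] by metis
      qed
      then show "\<exists>m. \<forall>x. response P (x(j := x j + d) \<circ> i) b = response P (x \<circ> i) b + m"
        by blast
    qed
  qed
qed

text \<open>Different letters of \<open>bs\<close> may have equal functions, so a letter finds its
  wire by its position in \<open>bs\<close> and not by its function.\<close>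

lemma available_network:
  assumes "available n (map F bs)" "distinct bs" "finite Z" "set bs \<inter> Z = {}"
    "\<And>b. b \<in> Z \<Longrightarrow> F b = (\<lambda>_. 0)"
  shows "\<exists>N V j. gate_network N V \<and> input_edges N = {..<n} \<and>
    bij_betw j (set bs \<union> Z) (output_edges N) \<and> (\<forall>b\<in>set bs \<union> Z. V (j b) = F b)"
proof -
  obtain N V ws where N: "gate_network N V" "input_edges N = {..<n}" "output_edges N = {}"
    "distinct ws" "set ws \<subseteq> trash_edges N" "map V ws = map F bs"
    using assms(1) unfolding available_def by blast
  have "abelian_network N"
    using N(1) unfolding gate_network_def valued_network_def by blast
  then interpret N: abelian_network N .
  obtain m where m: "\<And>e. e \<in> edges N \<Longrightarrow> e < m"
    using N.finite_edges unfolding finite_nat_set_iff_bounded by blast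
  have len: "length ws = length bs" using N(6) map_eq_imp_length_eq by blast
  have "\<forall>b\<in>set bs. \<exists>p. p < length bs \<and> bs ! p = b" by (simp add: in_set_conv_nth)
  then obtain p where p: "\<And>b. b \<in> set bs \<Longrightarrow> p b < length bs" "\<And>b. b \<in> set bs \<Longrightarrow> bs ! p b = b"
    by metis
  obtain h where h: "bij_betw h Z {0..<card Z}"
    using ex_bij_betw_finite_nat[OF assms(3)] by blast
  \<comment> \<open>The edges for \<open>Z\<close> start at \<open>m\<close>, above all edges of
    \<open>N\<close>, and so are fresh.\<close>
  define j where "j b = (if b \<in> Z then m + h b else ws ! p b)" for b
  have ws_less: "e < m" if "e \<in> set ws" for e
    using that N(5) N.dangling_subset m by blast
  have j_old: "j b \<in> set ws" "V (j b) = F b" if "b \<in> set bs" for b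
  proof -
    have b: "b \<notin> Z" using that assms(4) by blast
    show "j b \<in> set ws" using b p(1)[OF that] len by (simp add: j_def)
    have "map V ws ! p b = map F bs ! p b" using N(6) by simp
    then show "V (j b) = F b" using b p[OF that] len by (simp add: j_def)
  qed
  have "inj_on j (set bs)"
  proof (rule inj_onI)
    fix b c assume bc: "b \<in> set bs" "c \<in> set bs" "j b = j c"
    then have "ws ! p b = ws ! p c" using assms(4) by (auto simp: j_def split: if_splits)
    then have "p b = p c" using N(4) p(1) bc len by (simp add: nth_eq_iff_index_eq)
    then show "b = c" using p(2) bc by metis
  qed
  moreover have "inj_on j Z"
    using bij_betw_imp_inj_on[OF h] by (auto simp: j_def inj_on_def)
  moreover have "j ` set bs \<inter> j ` Z = {}"
    using j_old(1) ws_less by (fastforce simp: j_def)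
  moreover have "set bs - Z = set bs" "Z - set bs = Z" using assms(4) by auto
  ultimately have inj: "inj_on j (set bs \<union> Z)" by (simp add: inj_on_Un)
  let ?N = "select_outputs N (j ` set bs) (j ` Z)"
  have Z_fresh: "j ` Z \<inter> edges N = {}" using m by (fastforce simp: j_def)
  have "gate_network ?N (\<lambda>e x. if e \<in> j ` Z then 0 else V e x)"
    using N(1,3,5) j_old(1) assms(3) Z_fresh by (intro gate_network_select_outputs) auto
  moreover have "input_edges ?N = {..<n}" using N(2) by (simp add: select_outputs_def)
  moreover have "bij_betw j (set bs \<union> Z) (output_edges ?N)"
    using inj by (simp add: bij_betw_def select_outputs_def image_Un)
  moreover have "(\<lambda>x. if j b \<in> j ` Z then 0 else V (j b) x) = F b" if "b \<in> set bs \<union> Z" for b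
  proof (cases "b \<in> Z")
    case True
    then show ?thesis using assms(5) by simp
  next
    case False
    then have b: "b \<in> set bs" using that by simp
    then have "j b \<notin> j ` Z" using j_old(1) N(5) N.dangling_subset Z_fresh by blast
    then show ?thesis using j_old(2)[OF b] by simp
  qed
  ultimately show ?thesis
    by (intro exI[of _ ?N] exI[of _ "\<lambda>e x. if e \<in> j ` Z then 0 else V e x"] exI[of _ j]) blast
qed

theorem theorem1p3:
  fixes P :: "('q, 'a, 'b) processor"
  assumes "finite_abelian_processor P"
    and "recurrent P"
  shows "\<exists>N :: (nat, nat, nat) network.
    abelian_network N \<and> directed_acyclic N \<and>
    (\<forall>v \<in> nodes N. is_adder (node_processor N v) \<or> is_splitter (node_processor N v) \<or>
      is_toppler (node_processor N v)) \<and>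
    emulates N P"
proof -
  interpret finite_abelian_processor P by (rule assms(1))
  define n where "n = card (inputs P)"
  obtain i where i: "bij_betw i (inputs P) {..<n}"
    using ex_bij_betw_finite_nat[OF finite_inputs] unfolding n_def atLeast0LessThan by blast
  define F where "F b = (\<lambda>x. response P (x \<circ> i) b)" for b
  \<comment> \<open>The letters of \<open>Z\<close> are never emitted on any input; all others have
    a nonzero function and hence a proper \<open>gate_function\<close>.\<close>
  define Z where "Z = {b \<in> outputs P. F b = (\<lambda>_. 0)}"
  obtain bs where bs: "set bs = outputs P - Z" "distinct bs"
    using finite_distinct_list finite_outputs by (metis finite_Diff)
  have "gate_function n (F b)" if "b \<in> set bs" for b
    using gate_function0_response[OF assms(2) i, of b] that bs
    by (auto simp: gate_function0_def F_def Z_def)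
  then have "available n (map F bs)"
    by (intro available_gate_functions) auto
  moreover have Z: "finite Z" "set bs \<inter> Z = {}"
    using finite_outputs bs by (auto simp: Z_def)
  moreover have "F b = (\<lambda>_. 0)" if "b \<in> Z" for b
    using that by (simp add: Z_def)
  ultimately have "\<exists>N V j. gate_network N V \<and> input_edges N = {..<n} \<and>
      bij_betw j (set bs \<union> Z) (output_edges N) \<and> (\<forall>b\<in>set bs \<union> Z. V (j b) = F b)"
    using bs(2) by (intro available_network)
  moreover have "set bs \<union> Z = outputs P" using bs(1) by (auto simp: Z_def)
  ultimately obtain N V j where N: "gate_network N V" "input_edges N = {..<n}"
    "bij_betw j (outputs P) (output_edges N)" "\<And>b. b \<in> outputs P \<Longrightarrow> V (j b) = F b"
    by metis
  have "emulates N P"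
    unfolding emulates_def
  proof (intro exI conjI allI ballI)
    show "bij_betw i (inputs P) (input_edges N)" using i N(2) by simp
    show "bij_betw j (outputs P) (output_edges N)" by (rule N(3))
    show "processor_computes P (response P)" by (rule computes_response)
    show "network_computes N (\<lambda>x e. V e x)" using N(1) by (rule gate_network_computes)
    show "V (j b) x = response P (x \<circ> i) b" if "b \<in> outputs P" for x b
      using N(4)[OF that] by (simp add: F_def)
  qed
  moreover have "abelian_network N"
    using N(1) unfolding gate_network_def valued_network_def by blast
  moreover have "directed_acyclic N" using N(1) by (rule gate_network_acyclic)
  moreover have "\<forall>v \<in> nodes N. is_adder (node_processor N v) \<or> is_splitter (node_processor N v) \<or>
      is_toppler (node_processor N v)"
    using N(1) by (simp add: gate_network_def is_gate_def)
  ultimately show ?thesis by blast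
qed

end
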